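(* Suppose $\omega(x)\le1/\|x\|$ for all $x\in\mathbb{R}^d\setminus\{0\}$, and let $t>0$. For all integers $\ell>1$ and all $u,v>0$, $$\mathbb{P}\Big(\sup_{V\in\mathcal{V}_p}|\hat R_t(V)-R_t(V)|\ge\Big[(p\wedge(d-p))\Big(\frac{\tilde S_t}{\ell-1}+\frac v\ell\Big)\Big]^{1/2}+u\,\Big|\,N_t=\ell\Big)\le2\exp(-2\ell u^2)+\exp\big(-\lfloor\ell/2\rfloor v^2/2\big)$$ with $\tilde S_t:=N_t^{-1}\sum_{i=1}^n\|\Theta_{i,t}\|^4-\operatorname{tr}\Big(\big(N_t^{-1}\sum_{i=1}^n\Theta_{i,t}\Theta_{i,t}^\top\big)^2\Big)$. Let $\alpha\in(0,1)$. If, for all $\ell>1$, constants $u_\ell,v_\ell>0$ are chosen such that $2\exp(-2\ell u_\ell^2)+\exp(-\lfloor\ell/2\rfloor v_\ell^2/2)=1-\alpha$, then $I_\ell(V):=[\hat R_t(V)-B_{t,\ell},\hat R_t(V)+B_{t,\ell}]\cap[0,\infty)$ with $$B_{t,\ell}:=\Big[(p\wedge(d-p))\Big(\frac{\tilde S_t}{\ell-1}+\frac{v_\ell}{\ell}\Big)\Big]^{1/2}+u_\ell$$ defines a uniform level $\alpha$ confidence band for $R_t(V)$, $V\in\mathcal{V}_p$, conditionally on $N_t=\ell$, i.e. $\mathbb{P}\big(R_t(V)\in I_\ell(V)\ \forall V\in\mathcal{V}_p\mid N_t=\ell\big)\ge\alpha$. If one defines $I_0(V)=I_1(V)=[0,\infty)$,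 then $I_{N_t}(V)$ defines a uniform level $\alpha$ confidence band for $R_t(V)$, $V\in\mathcal{V}_p$, unconditionally, i.e. $\mathbb{P}\big(R_t(V)\in I_{N_t}(V)\ \forall V\in\mathcal{V}_p\big)\ge\alpha$.
   Context: Let $\|\cdot\|$ be the Euclidean norm on $\mathbb{R}^d$. $X$ is an $\mathbb{R}^d$-valued random vector (probability $\mathbb{P}$, expectation $\mathbb{E}$) that is regularly varying: there exist a function $b:(0,\infty)\to(0,\infty)$ and a non-zero Borel measure $\mu$ on $\mathbb{R}^d\setminus\{0\}$ such that $b(t)^{-1}\mathbb{P}(X\in tB)\to\mu(B)<\infty$ as $t\to\infty$ for all Borel sets $B$ bounded away from the origin with $\mu(\partial B)=0$ (in particular $\mathbb{P}\{\|X\|>t\}>0$ for all $t$). The cumulative distribution function of $\|X\|$ is continuous in the tail (continuous on $[s_0,\infty)$ for some $s_0$). The scaling function is a measurable $\omega:\mathbb{R}^d\setminus\{0\}\to(0,\infty)$; $\theta(x)=\omega(x)x$ for $x\neq0$, $\theta(0)=0$, $\Theta=\theta(X)$. $X_1,\dots,X_n$ are i.i.d. copies of $X$; $\Theta_{i,t}=\theta(X_i)\mathbf{1}\{\|X_i\|>t\}$; $N_t=\sum_{i=1}^n\mathbf{1}\{\|X_i\|>t\}$. For a linear subspace $V$, $\mathbf{\Pi}_V^\perp$ is the orthogonal projection onto the orthogonal complement of $V$. $R_t(V)=\mathbb{E}(\|\mathbf{\Pi}_V^\perp\Theta\|^2\mid\|X\|>t)$ and $\hat R_t(V)=\frac1{N_t}\sum_{i=1}^n\|\mathbf{\Pi}_V^\perp\Theta_{i,t}\|^2$.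 $\mathcal{V}_p$ ($1\le p\le d$) is the set of $p$-dimensional linear subspaces of $\mathbb{R}^d$; $a\wedge b=\min(a,b)$; $\operatorname{tr}$ is the trace; $\lfloor x\rfloor=\max\{m\in\mathbb{Z}:m\le x\}$. Statements conditional on $N_t=\ell$ concern those $\ell$ with $\mathbb{P}(N_t=\ell)>0$. In this statement $\alpha$ denotes the confidence level. *)

theory Defs
  imports "HOL-Probability.Probability"
begin

text \<open>
  The limit measure is required to be finite on all Borel sets bounded away from the origin, not
  only on its continuity sets, as usual for \<open>M\<^sub>0\<close>-convergence.  Otherwise the measure that is
  infinite on every non-empty Borel set, which has no non-empty continuity set bounded away from
  the origin, would be a limit measure for every \<open>X\<close>.
  If \<open>0 \<notin> closure B\<close>, it does not matter whether the boundary of \<open>B\<close> is taken in the whole space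
  or in the space without the origin.
\<close>

definition regularly_varying :: "'a measure \<Rightarrow> ('a \<Rightarrow> real^'d) \<Rightarrow> bool" where
  "regularly_varying M X \<longleftrightarrow>
     (\<exists>(b :: real \<Rightarrow> real) (\<mu> :: (real^'d) measure).
        (\<forall>t>0. b t > 0) \<and>
        sets \<mu> = sets (restrict_space borel (- {0})) \<and>
        emeasure \<mu> (space \<mu>) \<noteq> 0 \<and>
        (\<forall>B \<in> sets borel. 0 \<notin> closure B \<longrightarrow> emeasure \<mu> B < \<infinity>) \<and>
        (\<forall>B \<in> sets borel. 0 \<notin> closure B \<longrightarrow> emeasure \<mu> (frontier B) = 0 \<longrightarrow>
           ((\<lambda>t. \<P>(w in M. X w \<in> (\<lambda>x. t *\<^sub>R x) ` B) / b t) \<longlongrightarrow> measure \<mu> B) at_top))"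

text \<open>Meaningful for subspaces \<open>W\<close>; see the lemma below.\<close>

definition orth_proj :: "(real^'d) set \<Rightarrow> real^'d \<Rightarrow> real^'d" where
  "orth_proj W x = (THE y. y \<in> W \<and> x - y \<in> W\<^sup>\<bottom>)"

lemma orth_proj_ex1:
  fixes W :: "(real^'d) set"
  assumes "subspace W"
  shows "\<exists>!y. y \<in> W \<and> x - y \<in> W\<^sup>\<bottom>"
proof (rule ex_ex1I)
  obtain y z where "y \<in> span W" "\<And>w. w \<in> span W \<Longrightarrow> orthogonal z w" "x = y + z"
    using orthogonal_subspace_decomp_exists [of W x] by metis
  moreover have "span W = W"
    using assms by simp
  ultimately show "\<exists>y. y \<in> W \<and> x - y \<in> W\<^sup>\<bottom>"
    by (intro exI [of _ y]) (auto simp: orthogonal_comp_def orthogonal_commute)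
next
  fix y y' assume *: "y \<in> W \<and> x - y \<in> W\<^sup>\<bottom>" "y' \<in> W \<and> x - y' \<in> W\<^sup>\<bottom>"
  have "y' - y \<in> W"
    using * assms by (blast intro: subspace_diff)
  moreover have "(x - y) - (x - y') \<in> W\<^sup>\<bottom>"
    using * by (blast intro: subspace_diff subspace_orthogonal_comp)
  ultimately have "(y' - y) \<bullet> (y' - y) = 0"
    by (auto simp: orthogonal_comp_def orthogonal_def)
  then show "y = y'"
    by simp
qed

definition subspaces_of_dim :: "nat \<Rightarrow> (real^'d) set set" where
  "subspaces_of_dim p = {V. subspace V \<and> dim V = p}"

definition theta :: "(real^'d \<Rightarrow> real) \<Rightarrow> real^'d \<Rightarrow> real^'d" where
  "theta \<omega> x = (if x = 0 then 0 else \<omega> x *\<^sub>R x)"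

definition theta_exc :: "(real^'d \<Rightarrow> real) \<Rightarrow> real \<Rightarrow> real^'d \<Rightarrow> real^'d" where
  "theta_exc \<omega> t x = (if norm x > t then theta \<omega> x else 0)"

definition true_risk ::
  "'a measure \<Rightarrow> (real^'d \<Rightarrow> real) \<Rightarrow> ('a \<Rightarrow> real^'d) \<Rightarrow> real \<Rightarrow> (real^'d) set \<Rightarrow> real" where
  "true_risk M \<omega> X t V =
     (\<integral>w. (norm (orth_proj (V\<^sup>\<bottom>) (theta \<omega> (X w))))\<^sup>2
        \<partial>uniform_measure M {w \<in> space M. norm (X w) > t})"

text \<open>
  The remaining definitions concern a realisation \<open>x 1, \<dots>, x n\<close> of the sample.
\<close>

definition num_exc :: "nat \<Rightarrow> real \<Rightarrow> (nat \<Rightarrow> real^'d) \<Rightarrow> nat" where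
  "num_exc n t x = (\<Sum>i=1..n. of_bool (norm (x i) > t))"

definition emp_risk ::
  "(real^'d \<Rightarrow> real) \<Rightarrow> nat \<Rightarrow> real \<Rightarrow> (nat \<Rightarrow> real^'d) \<Rightarrow> (real^'d) set \<Rightarrow> real" where
  "emp_risk \<omega> n t x V =
     1 / real (num_exc n t x) * (\<Sum>i=1..n. (norm (orth_proj (V\<^sup>\<bottom>) (theta_exc \<omega> t (x i))))\<^sup>2)"

definition outer_square :: "real^'d \<Rightarrow> real^'d^'d" where
  "outer_square y = (\<chi> i j. y $ i * y $ j)"

definition emp_moment_matrix ::
  "(real^'d \<Rightarrow> real) \<Rightarrow> nat \<Rightarrow> real \<Rightarrow> (nat \<Rightarrow> real^'d) \<Rightarrow> real^'d^'d" where
  "emp_moment_matrix \<omega> n t x =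
     (1 / real (num_exc n t x)) *\<^sub>R (\<Sum>i=1..n. outer_square (theta_exc \<omega> t (x i)))"

definition S_tilde ::
  "(real^'d \<Rightarrow> real) \<Rightarrow> nat \<Rightarrow> real \<Rightarrow> (nat \<Rightarrow> real^'d) \<Rightarrow> real" where
  "S_tilde \<omega> n t x =
     1 / real (num_exc n t x) * (\<Sum>i=1..n. norm (theta_exc \<omega> t (x i)) ^ 4)
     - trace (emp_moment_matrix \<omega> n t x ** emp_moment_matrix \<omega> n t x)"

text \<open>
  Below, \<open>l\<close> is the number of exceedances; \<open>u\<close> and \<open>v\<close> in \<open>conf_band\<close> are the sequences of
  constants \<open>u\<^sub>l\<close>, \<open>v\<^sub>l\<close>, whose values at \<open>0\<close> and \<open>1\<close> are irrelevant.
\<close>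

definition band_radius ::
  "(real^'d \<Rightarrow> real) \<Rightarrow> nat \<Rightarrow> nat \<Rightarrow> real \<Rightarrow> nat \<Rightarrow> real \<Rightarrow> real \<Rightarrow> (nat \<Rightarrow> real^'d) \<Rightarrow> real" where
  "band_radius \<omega> p n t l u v x =
     sqrt (real (min p (CARD('d) - p)) * (S_tilde \<omega> n t x / (real l - 1) + v / real l)) + u"

definition conf_band ::
  "(real^'d \<Rightarrow> real) \<Rightarrow> nat \<Rightarrow> nat \<Rightarrow> real \<Rightarrow> (nat \<Rightarrow> real) \<Rightarrow> (nat \<Rightarrow> real) \<Rightarrow> nat
     \<Rightarrow> (nat \<Rightarrow> real^'d) \<Rightarrow> (real^'d) set \<Rightarrow> real set" where
  "conf_band \<omega> p n t u v l x V =
     (if l \<le> 1 then {0..}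
      else {emp_risk \<omega> n t x V - band_radius \<omega> p n t l (u l) (v l) x ..
            emp_risk \<omega> n t x V + band_radius \<omega> p n t l (u l) (v l) x} \<inter> {0..})"

end

theory Submission
  imports Defs
begin

text \<open>
  For a \<open>p\<close>-dimensional subspace \<open>V\<close> let \<open>P\<close> be the matrix of the orthogonal projection onto
  \<open>V\<^sup>\<bottom>\<close>.  Since the squared norm of the projection of \<open>y\<close> is the Frobenius inner product of \<open>P\<close>
  with the outer square of \<open>y\<close>, the true and the empirical risk of \<open>V\<close> are the inner products of \<open>P\<close>
  with one and the same matrix for all \<open>V\<close>: the second moment matrix \<open>\<mu>\<close> of \<open>\<Theta>\<close> given an exceedance,
  and its empirical counterpart.  With \<open>D\<close> the difference of the two matrices, the theorem bounds the
  supremum over \<open>V\<close> of the absolute inner product of \<open>P\<close> and \<open>D\<close>.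

  Size in expectation.  \<open>P\<close> has Frobenius norm \<open>sqrt (d - p)\<close>, so Cauchy-Schwarz bounds the supremum of
  the inner products by \<open>sqrt (d - p)\<close> times the norm of \<open>D\<close>.  Also, \<open>P\<close> is the identity minus a matrix
  of norm \<open>sqrt p\<close>, which gives the bound trace of \<open>D\<close> plus \<open>sqrt p\<close> times the norm of \<open>D\<close>.  The trace of
  \<open>D\<close> need not vanish if \<open>\<omega> x\<close> is smaller than \<open>1 / norm x\<close>, but its expectation does.  Hence the
  factor \<open>min p (d - p)\<close>; and as the trace cancels only in expectation and before taking absolute
  values, the suprema for \<open>D\<close> and for \<open>- D\<close> are treated separately, each with its own exponential
  term.  Given \<open>l\<close> exceedances, the norm of \<open>D\<close> has expectation at most \<open>sqrt (\<sigma> / l)\<close>, where \<open>\<sigma>\<close> is the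
  variance of the outer square of \<open>\<Theta>\<close>.

  Concentration.  Outer squares of vectors of norm at most one have inner products with \<open>P\<close> in \<open>[0, 1]\<close>,
  so replacing one of the \<open>l\<close> exceedances changes each supremum by at most \<open>1 / l\<close>, and McDiarmid's
  inequality gives the term \<open>exp (- 2 l u\<^sup>2)\<close> twice.  The unknown \<open>\<sigma>\<close> is replaced by its unbiased estimator
  \<open>l / (l - 1)\<close> times the statistic \<open>S_tilde\<close>.  Written as a sum over pairs, it changes by at most \<open>2 / l\<close>
  if one exceedance is replaced, so McDiarmid's inequality also gives
  \<open>exp (- l v\<^sup>2 / 2)\<close>, which is at most the last term of the claim.  These facts are combined in
  \<open>uniform_residual_deviation\<close>.

  Conditioning.  The event that \<open>N = l\<close> is the disjoint union over index sets \<open>J\<close> of size \<open>l\<close> of the events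
  that exactly the observations in \<open>J\<close> exceed \<open>t\<close>.  Such an event is a rectangle in the independent
  observations, so conditioning on it leaves them independent, and those in \<open>J\<close> follow
  the law of \<open>X\<close> given an exceedance.  Summation over \<open>J\<close> gives the first claim; the coverage
  statements follow by passing to complements and summing over \<open>l\<close>.
\<close>

section \<open>McDiarmid's bounded difference inequality\<close>

text \<open>Moving from \<open>x\<close> to \<open>y\<close> one coordinate at a time shows that bounded differences imply boundedness;
  this makes the expectation in McDiarmid's inequality exist.\<close>

lemma abs_diff_le_sum_bounded_differences:
  fixes f :: "('i \<Rightarrow> 'a) \<Rightarrow> real"
  assumes "finite I" and x: "x \<in> Pi\<^sub>E I S" and y: "y \<in> Pi\<^sub>E I S"
    and diff: "\<And>x i a. x \<in> Pi\<^sub>E I S \<Longrightarrow> i \<in> I \<Longrightarrow> a \<in> S i \<Longrightarrow> \<bar>f (x(i := a)) - f x\<bar> \<le> c i"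
  shows "\<bar>f y - f x\<bar> \<le> (\<Sum>i\<in>I. c i)"
proof -
  have "\<bar>f (override_on x y K) - f x\<bar> \<le> (\<Sum>i\<in>K. c i)" if "K \<subseteq> I" for K
    using finite_subset[OF that \<open>finite I\<close>] that
  proof (induction K rule: finite_induct)
    case (insert i K)
    have "override_on x y K \<in> Pi\<^sub>E I S"
      using x y by (auto simp: PiE_iff override_on_def extensional_def)
    from diff[OF this, of i "y i"] have "\<bar>f (override_on x y (insert i K)) - f (override_on x y K)\<bar> \<le> c i"
      using insert y by (auto simp: override_on_insert)
    with insert show ?case by auto
  qed simp
  moreover have "override_on x y I = y"
    using x y by (auto simp: PiE_iff override_on_def extensional_def fun_eq_iff)
  ultimately show ?thesis by (metis order_refl)
qed

lemma (in prob_space) abs_expectation_le: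
  fixes f :: "'a \<Rightarrow> real"
  assumes "integrable M f" "\<And>x. x \<in> space M \<Longrightarrow> \<bar>f x\<bar> \<le> B"
  shows "\<bar>expectation f\<bar> \<le> B"
  using integral_le_const[OF assms(1), of B] integral_ge_const[OF assms(1), of "- B"] assms(2)
  by (auto simp: abs_le_iff minus_le_iff intro: AE_I2)

text \<open>
  Induction on the index set: for a new coordinate \<open>i\<close>, let \<open>g x\<close> be the integral of \<open>f\<close> over that
  coordinate alone.  For fixed \<open>x\<close>, the function \<open>f - g x\<close> of the new coordinate is centred and
  takes values in an interval of length \<open>c i\<close>, so Hoeffding's lemma bounds its
  exponential moment uniformly in \<open>x\<close>, while \<open>g\<close> inherits the bounded differences of \<open>f\<close> in the
  remaining coordinates.
\<close>

lemma (in product_prob_space) nn_integral_exp_bounded_differences: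
  fixes f :: "('i \<Rightarrow> 'a) \<Rightarrow> real"
  assumes "finite I" and f: "f \<in> borel_measurable (Pi\<^sub>M I M)"
    and bnd: "\<And>x. x \<in> space (Pi\<^sub>M I M) \<Longrightarrow> \<bar>f x\<bar> \<le> B"
    and diff: "\<And>x i a. x \<in> space (Pi\<^sub>M I M) \<Longrightarrow> i \<in> I \<Longrightarrow> a \<in> space (M i)
                 \<Longrightarrow> \<bar>f (x(i := a)) - f x\<bar> \<le> c i"
    and l: "l > 0"
  shows "(\<integral>\<^sup>+x. exp (l * (f x - integral\<^sup>L (Pi\<^sub>M I M) f)) \<partial>Pi\<^sub>M I M)
           \<le> exp (l\<^sup>2 / 8 * (\<Sum>i\<in>I. (c i)\<^sup>2))"
  using \<open>finite I\<close> f bnd diff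
proof (induction I arbitrary: f rule: finite_induct)
  case empty
  show ?case
    by (simp add: PiM_empty nn_integral_count_space_finite lebesgue_integral_count_space_finite)
next
  case (insert i I)
  note [measurable] = insert.prems(1)
  interpret PI: prob_space "Pi\<^sub>M I M" by (rule prob_space_PiM) unfold_locales
  interpret Q: prob_space "Pi\<^sub>M (insert i I) M" by (rule prob_space_PiM) unfold_locales
  have upd: "x(i := a) \<in> space (Pi\<^sub>M (insert i I) M)"
    if "x \<in> space (Pi\<^sub>M I M)" "a \<in> space (M i)" for x a
    using that by (auto simp: space_PiM PiE_iff extensional_def)
  have [measurable]: "(\<lambda>a. f (x(i := a))) \<in> borel_measurable (M i)" if "x \<in> space (Pi\<^sub>M I M)" for x
    by (rule measurable_compose[OF measurable_component_update insert.prems(1)])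
       (use that insert.hyps in auto)
  have meas2 [measurable]: "(\<lambda>(x, a). f (x(i := a))) \<in> borel_measurable (Pi\<^sub>M I M \<Otimes>\<^sub>M M i)"
    using measurable_compose[OF measurable_add_dim insert.prems(1)] by (simp add: case_prod_unfold)
  have int_a: "integrable (M i) (\<lambda>a. f (x(i := a)))" if "x \<in> space (Pi\<^sub>M I M)" for x
    using that by (intro M.integrable_const_bound[where B=B]) (auto intro!: AE_I2 insert.prems(2) upd)
  define g where "g = (\<lambda>x. \<integral>a. f (x(i := a)) \<partial>M i)"
  have g [measurable]: "g \<in> borel_measurable (Pi\<^sub>M I M)"
    unfolding g_def by measurable
  have "B \<ge> 0"
    using insert.prems(2) Q.not_empty by (meson abs_ge_zero all_not_in_conv order_trans)
  have g_bnd: "\<bar>g x\<bar> \<le> B" if x: "x \<in> space (Pi\<^sub>M I M)" for x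
    unfolding g_def using x by (intro M.abs_expectation_le int_a insert.prems(2) upd)
  have g_diff: "\<bar>g (x(j := b)) - g x\<bar> \<le> c j"
    if x: "x \<in> space (Pi\<^sub>M I M)" and j: "j \<in> I" and b: "b \<in> space (M j)" for x j b
  proof -
    have xj: "x(j := b) \<in> space (Pi\<^sub>M I M)"
      using x j b by (auto simp: space_PiM PiE_iff extensional_def)
    have "g (x(j := b)) - g x = (\<integral>a. f (x(j := b, i := a)) - f (x(i := a)) \<partial>M i)"
      unfolding g_def using int_a[OF x] int_a[OF xj] by simp
    also have "\<bar>\<dots>\<bar> \<le> c j"
    proof (rule M.abs_expectation_le)
      fix a assume a: "a \<in> space (M i)"
      have "i \<noteq> j" using j insert.hyps by auto
      then show "\<bar>f (x(j := b, i := a)) - f (x(i := a))\<bar> \<le> c j"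
        using insert.prems(3)[OF upd[OF x a] _ b] j by (metis fun_upd_twist insertI2)
    qed (use int_a[OF x] int_a[OF xj] in auto)
    finally show ?thesis .
  qed
  define m where "m = integral\<^sup>L (Pi\<^sub>M (insert i I) M) f"
  have m: "m = integral\<^sup>L (Pi\<^sub>M I M) g"
    unfolding m_def g_def using insert.hyps
    by (intro product_integral_insert Q.integrable_const_bound[where B=B])
       (auto intro!: AE_I2 insert.prems(2))
  have inner: "(\<integral>\<^sup>+a. exp (l * (f (x(i := a)) - g x)) \<partial>M i) \<le> exp (l\<^sup>2 * (c i)\<^sup>2 / 8)"
    if x: "x \<in> space (Pi\<^sub>M I M)" for x
  proof -
    let ?S = "(\<lambda>a. f (x(i := a))) ` space (M i)"
    have bdd: "bdd_below ?S"
      using insert.prems(2) upd[OF x] by (intro bdd_belowI2[where m="-B"]) (force simp: abs_le_iff)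
    interpret interval_bounded_random_variable "M i" "\<lambda>a. f (x(i := a))" "Inf ?S" "Inf ?S + c i"
    proof unfold_locales
      show "(\<lambda>a. f (x(i := a))) \<in> borel_measurable (M i)" using x by measurable
      show "AE a in M i. f (x(i := a)) \<in> {Inf ?S..Inf ?S + c i}"
      proof (rule AE_I2)
        fix a assume a: "a \<in> space (M i)"
        have "f (x(i := a)) - c i \<le> Inf ?S"
        proof (rule cInf_greatest)
          show "?S \<noteq> {}" using a by auto
          fix r assume "r \<in> ?S"
          then obtain a' where a': "a' \<in> space (M i)" "r = f (x(i := a'))" by auto
          show "f (x(i := a)) - c i \<le> r"
            using insert.prems(3)[OF upd[OF x a'(1)] insertI1 a] a'(2) by (simp del: fun_upd_apply)
        qed
        moreover have "Inf ?S \<le> f (x(i := a))" using a bdd by (intro cInf_lower) auto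
        ultimately show "f (x(i := a)) \<in> {Inf ?S..Inf ?S + c i}" by auto
      qed
    qed
    show ?thesis using Hoeffdings_lemma_nn_integral[OF l] by (simp add: g_def)
  qed
  have "(\<integral>\<^sup>+x. exp (l * (f x - m)) \<partial>Pi\<^sub>M (insert i I) M)
      = (\<integral>\<^sup>+x. \<integral>\<^sup>+a. exp (l * (f (x(i := a)) - m)) \<partial>M i \<partial>Pi\<^sub>M I M)"
    using insert.hyps by (intro product_nn_integral_insert) auto
  also have "\<dots> = (\<integral>\<^sup>+x. exp (l * (g x - m)) * (\<integral>\<^sup>+a. exp (l * (f (x(i := a)) - g x)) \<partial>M i) \<partial>Pi\<^sub>M I M)"
    by (intro nn_integral_cong)
       (simp flip: nn_integral_cmult ennreal_mult exp_add add: algebra_simps)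
  also have "\<dots> \<le> (\<integral>\<^sup>+x. exp (l * (g x - m)) * ennreal (exp (l\<^sup>2 * (c i)\<^sup>2 / 8)) \<partial>Pi\<^sub>M I M)"
    by (intro nn_integral_mono mult_left_mono inner) auto
  also have "\<dots> = (\<integral>\<^sup>+x. exp (l * (g x - m)) \<partial>Pi\<^sub>M I M) * ennreal (exp (l\<^sup>2 * (c i)\<^sup>2 / 8))"
    by (intro nn_integral_multc) auto
  also have "\<dots> \<le> ennreal (exp (l\<^sup>2 / 8 * (\<Sum>j\<in>I. (c j)\<^sup>2))) * ennreal (exp (l\<^sup>2 * (c i)\<^sup>2 / 8))"
    unfolding m by (intro mult_right_mono insert.IH g g_bnd g_diff) auto
  also have "\<dots> = exp (l\<^sup>2 / 8 * (\<Sum>j\<in>insert i I. (c j)\<^sup>2))"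
    using insert.hyps by (simp flip: ennreal_mult exp_add add: algebra_simps)
  finally show ?case unfolding m_def .
qed

text \<open>Chernoff's bound applied to the exponential moment above, transferred to random variables: by
  independence their joint law is a product measure.\<close>

theorem (in prob_space) McDiarmid_inequality:
  fixes f :: "('i \<Rightarrow> 'b) \<Rightarrow> real"
  assumes "finite I" and indep: "indep_vars N X I"
    and f [measurable]: "f \<in> borel_measurable (Pi\<^sub>M I N)"
    and diff: "\<And>x i a. x \<in> space (Pi\<^sub>M I N) \<Longrightarrow> i \<in> I \<Longrightarrow> a \<in> space (N i)
                 \<Longrightarrow> \<bar>f (x(i := a)) - f x\<bar> \<le> c i"
    and pos: "(\<Sum>i\<in>I. (c i)\<^sup>2) > 0" and u: "u > 0"
  shows "prob {w \<in> space M. f (\<lambda>i\<in>I. X i w) \<ge> expectation (\<lambda>w. f (\<lambda>i\<in>I. X i w)) + u}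
           \<le> exp (- 2 * u\<^sup>2 / (\<Sum>i\<in>I. (c i)\<^sup>2))"
proof -
  have rv: "X i \<in> measurable M (N i)" if "i \<in> I" for i
    using indep that by (auto simp: indep_vars_def)
  have "I \<noteq> {}" using pos by auto
  then obtain j where j: "j \<in> I" by auto
  \<comment> \<open>Product measures are indexed by the whole type; outside \<open>I\<close> any probability measure will do.\<close>
  define D where "D i = (if i \<in> I then distr M (N i) (X i) else distr M (N j) (X j))" for i
  have D: "prob_space (D i)" for i
    using rv j by (auto simp: D_def intro!: prob_space_distr)
  interpret D: product_prob_space D I
    using D by (simp add: product_prob_space_def product_prob_space_axioms_def product_sigma_finite_def
        prob_space_imp_sigma_finite)
  have sets_D: "sets (Pi\<^sub>M I D) = sets (Pi\<^sub>M I N)"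
    by (intro sets_PiM_cong) (auto simp: D_def)
  have space_D: "space (Pi\<^sub>M I D) = space (Pi\<^sub>M I N)"
    by (rule sets_eq_imp_space_eq[OF sets_D])
  have f_D [measurable]: "f \<in> borel_measurable (Pi\<^sub>M I D)"
    using f by (simp add: measurable_cong_sets[OF sets_D refl])
  have joint: "distr M (Pi\<^sub>M I N) (\<lambda>w. \<lambda>i\<in>I. X i w) = Pi\<^sub>M I D"
    using indep_vars_iff_distr_eq_PiM'[OF \<open>I \<noteq> {}\<close>, where M'=N and X=X] rv indep
    by (auto simp: D_def intro!: PiM_cong)
  have X [measurable]: "(\<lambda>w. \<lambda>i\<in>I. X i w) \<in> measurable M (Pi\<^sub>M I N)"
    by (intro measurable_restrict rv)
  define m where "m = expectation (\<lambda>w. f (\<lambda>i\<in>I. X i w))"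
  have m: "m = integral\<^sup>L (Pi\<^sub>M I D) f"
    unfolding m_def by (subst joint[symmetric], rule integral_distr[symmetric]) measurable
  define d where "d = (\<Sum>i\<in>I. (c i)\<^sup>2)"
  \<comment> \<open>The minimiser of \<open>l\<^sup>2 / 8 * d - l * u\<close>.\<close>
  define l where "l = 4 * u / d"
  have d: "d > 0" and l: "l > 0"
    using pos u by (auto simp: d_def l_def)
  obtain x0 where x0: "x0 \<in> space (Pi\<^sub>M I N)"
    using D.P.not_empty unfolding space_D by blast
  have bnd: "\<bar>f x\<bar> \<le> \<bar>f x0\<bar> + (\<Sum>i\<in>I. c i)" if "x \<in> space (Pi\<^sub>M I N)" for x
  proof -
    have "\<bar>f x - f x0\<bar> \<le> (\<Sum>i\<in>I. c i)"
      using that x0 diff unfolding space_PiM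
      by (intro abs_diff_le_sum_bounded_differences[where S="\<lambda>i. space (N i)"] \<open>finite I\<close>)
    then show ?thesis by linarith
  qed
  have "ennreal (prob {w \<in> space M. f (\<lambda>i\<in>I. X i w) \<ge> m + u})
      = emeasure M {w \<in> space M. f (\<lambda>i\<in>I. X i w) - m \<ge> u}"
    by (simp add: emeasure_eq_measure algebra_simps)
  also have "\<dots> \<le> ennreal (exp (- l * u)) * (\<integral>\<^sup>+w\<in>space M. exp (l * (f (\<lambda>i\<in>I. X i w) - m)) \<partial>M)"
    by (intro Chernoff_ineq_nn_integral_ge l) auto
  also have "(\<integral>\<^sup>+w\<in>space M. exp (l * (f (\<lambda>i\<in>I. X i w) - m)) \<partial>M)
      = (\<integral>\<^sup>+w. exp (l * (f (\<lambda>i\<in>I. X i w) - m)) \<partial>M)"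
    by (intro nn_integral_cong) auto
  also have "\<dots> = (\<integral>\<^sup>+x. exp (l * (f x - m)) \<partial>Pi\<^sub>M I D)"
    by (subst joint[symmetric], subst nn_integral_distr) auto
  also have "ennreal (exp (- l * u)) * \<dots> \<le> ennreal (exp (- l * u)) * ennreal (exp (l\<^sup>2 / 8 * d))"
    unfolding m d_def
    using bnd diff
    by (intro mult_left_mono D.nn_integral_exp_bounded_differences[OF \<open>finite I\<close> f_D _ _ l])
      (auto simp: space_D D_def simp del: fun_upd_apply)
  also have "ennreal (exp (- l * u)) * ennreal (exp (l\<^sup>2 / 8 * d)) = ennreal (exp (- 2 * u\<^sup>2 / d))"
  proof -
    have "- l * u + l\<^sup>2 / 8 * d = - 2 * u\<^sup>2 / d"
      using d by (simp add: l_def field_simps power2_eq_square)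
    then show ?thesis by (simp flip: ennreal_mult exp_add)
  qed
  finally show ?thesis
    unfolding d_def m_def by (simp only: ennreal_le_iff exp_ge_zero)
qed

section \<open>Projections and outer squares\<close>

lemma inner_outer_square: "outer_square x \<bullet> outer_square y = (x \<bullet> y)\<^sup>2"
  by (simp add: outer_square_def inner_vec_def power2_eq_square sum_product ac_simps)

lemma norm_outer_square: "norm (outer_square x) = (norm x)\<^sup>2"
  by (simp add: norm_eq_sqrt_inner inner_outer_square)

lemma orth_proj_eqI:
  assumes "subspace W" "y \<in> W" "x - y \<in> W\<^sup>\<bottom>"
  shows "orth_proj W x = y"
  unfolding orth_proj_def using orth_proj_ex1[OF assms(1), of x] assms(2,3)
  by (intro the1_equality) auto

lemma orth_proj_in:
  assumes "subspace W"
  shows "orth_proj W x \<in> W" "x - orth_proj W x \<in> W\<^sup>\<bottom>"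
  using theI'[OF orth_proj_ex1[OF assms, of x]] by (auto simp: orth_proj_def)

lemma orth_proj_orthogonal_comp:
  assumes "subspace W"
  shows "orth_proj (W\<^sup>\<bottom>) x = x - orth_proj W x"
  using orth_proj_in[OF assms, of x] orthogonal_comp_subset[of W]
  by (intro orth_proj_eqI subspace_orthogonal_comp) auto

text \<open>The matrix of a projection is the sum of the outer squares of an orthonormal basis of its range;
  Frobenius inner products with it thus reduce to the lemma on inner products of outer squares.\<close>

definition proj_matrix :: "(real^'d) set \<Rightarrow> real^'d^'d" where
  "proj_matrix W = matrix (orth_proj W)"

lemma proj_matrix_eq_sum_outer_square:
  fixes W :: "(real^'d) set"
  assumes "subspace W"
  obtains B where "finite B" "card B = dim W"
    "\<And>b c. b \<in> B \<Longrightarrow> c \<in> B \<Longrightarrow> b \<bullet> c = of_bool (b = c)"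
    "\<And>x. orth_proj W x = (\<Sum>b\<in>B. (b \<bullet> x) *\<^sub>R b)"
    "proj_matrix W = (\<Sum>b\<in>B. outer_square b)"
proof -
  obtain B where B: "B \<subseteq> W" "pairwise orthogonal B" "\<And>x. x \<in> B \<Longrightarrow> norm x = 1"
    "independent B" "card B = dim W" "span B = W"
    using orthonormal_basis_subspace[OF assms] by metis
  have fin: "finite B" using B by (simp add: independent_imp_finite)
  have orth: "b \<bullet> c = of_bool (b = c)" if "b \<in> B" "c \<in> B" for b c
    using B(2) B(3)[OF that(1)] that
    by (auto simp: pairwise_def orthogonal_def norm_eq_1)
  have eq: "orth_proj W x = (\<Sum>b\<in>B. (b \<bullet> x) *\<^sub>R b)" for x
  proof (rule orth_proj_eqI[OF assms])
    show "(\<Sum>b\<in>B. (b \<bullet> x) *\<^sub>R b) \<in> W"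
      using B(1) by (intro subspace_sum subspace_scale assms) auto
    have in_B: "orthogonal (x - (\<Sum>b\<in>B. (b \<bullet> x) *\<^sub>R b)) c" if "c \<in> B" for c
      using that fin
      by (simp add: orthogonal_def inner_diff_left inner_sum_left orth of_bool_def
          if_distrib sum.delta inner_commute[of x] cong: if_cong)
    have "orthogonal (x - (\<Sum>b\<in>B. (b \<bullet> x) *\<^sub>R b)) c" if "c \<in> W" for c
      by (rule orthogonal_to_span[of c B]) (use that B(6) in_B in auto)
    then show "x - (\<Sum>b\<in>B. (b \<bullet> x) *\<^sub>R b) \<in> W\<^sup>\<bottom>"
      by (auto simp: orthogonal_comp_def orthogonal_commute)
  qed
  have "proj_matrix W = (\<Sum>b\<in>B. outer_square b)"
    by (simp add: vec_eq_iff proj_matrix_def matrix_def outer_square_def eq inner_axis mult.commute)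
  with fin B(5) orth eq that show thesis by blast
qed

lemma proj_matrix_inner_outer_square:
  assumes "subspace W"
  shows "proj_matrix W \<bullet> outer_square x = (norm (orth_proj W x))\<^sup>2"
proof -
  obtain B where B: "finite B" "card B = dim W"
    "\<And>b c. b \<in> B \<Longrightarrow> c \<in> B \<Longrightarrow> b \<bullet> c = of_bool (b = c)"
    "\<And>x. orth_proj W x = (\<Sum>b\<in>B. (b \<bullet> x) *\<^sub>R b)" "proj_matrix W = (\<Sum>b\<in>B. outer_square b)"
    by (rule proj_matrix_eq_sum_outer_square[OF assms]) (rule that)
  have "(norm (orth_proj W x))\<^sup>2 = (\<Sum>b\<in>B. \<Sum>c\<in>B. (b \<bullet> x) * ((c \<bullet> x) * (c \<bullet> b)))"
    by (simp add: B(4) power2_norm_eq_inner inner_sum_left inner_sum_right sum_distrib_left)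
  also have "\<dots> = (\<Sum>b\<in>B. \<Sum>c\<in>B. if b = c then (b \<bullet> x)\<^sup>2 else 0)"
    by (intro sum.cong refl) (auto simp: B(3) power2_eq_square)
  also have "\<dots> = (\<Sum>b\<in>B. (b \<bullet> x)\<^sup>2)"
    using B(1) by simp
  finally show ?thesis
    by (simp add: B(5) inner_sum_left inner_outer_square)
qed

lemma norm_proj_matrix:
  assumes "subspace W"
  shows "norm (proj_matrix W) = sqrt (dim W)"
proof -
  obtain B where B: "finite B" "card B = dim W"
    "\<And>b c. b \<in> B \<Longrightarrow> c \<in> B \<Longrightarrow> b \<bullet> c = of_bool (b = c)"
    "\<And>x. orth_proj W x = (\<Sum>b\<in>B. (b \<bullet> x) *\<^sub>R b)" "proj_matrix W = (\<Sum>b\<in>B. outer_square b)"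
    by (rule proj_matrix_eq_sum_outer_square[OF assms]) (rule that)
  have "proj_matrix W \<bullet> proj_matrix W = (\<Sum>b\<in>B. \<Sum>c\<in>B. (b \<bullet> c)\<^sup>2)"
    unfolding B(5) inner_sum_left by (simp add: inner_sum_right inner_outer_square)
  also have "\<dots> = (\<Sum>b\<in>B. \<Sum>c\<in>B. if b = c then 1 else 0)"
    by (intro sum.cong refl) (auto simp: B(3))
  also have "\<dots> = dim W"
    using B(1,2) by simp
  finally show ?thesis by (simp add: norm_eq_sqrt_inner)
qed

lemma proj_matrix_orthogonal_comp:
  assumes "subspace W"
  shows "proj_matrix (W\<^sup>\<bottom>) = mat 1 - proj_matrix W"
  by (auto simp: vec_eq_iff proj_matrix_def matrix_def orth_proj_orthogonal_comp[OF assms] mat_def axis_def)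

lemma trace_eq_inner_mat_1: "trace A = mat 1 \<bullet> (A :: real^'d^'d)"
  by (simp add: trace_def inner_vec_def mat_def if_distrib if_distribR sum.delta cong: if_cong)

lemma trace_outer_square: "trace (outer_square x) = (norm x)\<^sup>2"
  by (simp add: trace_def outer_square_def power2_norm_eq_inner inner_vec_def)

text \<open>One squared residual lies between zero and the squared norm of the vector; this
  two-sided bound is what gives differences of size \<open>1 / l\<close> in McDiarmid's inequality.\<close>

lemma residual_outer_square:
  assumes "subspace V"
  shows "proj_matrix (V\<^sup>\<bottom>) \<bullet> outer_square x \<in> {0..(norm x)\<^sup>2}"
proof -
  have "proj_matrix (V\<^sup>\<bottom>) \<bullet> outer_square x = (norm x)\<^sup>2 - (norm (orth_proj V x))\<^sup>2"
    by (simp add: proj_matrix_orthogonal_comp[OF assms] inner_diff_left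
        proj_matrix_inner_outer_square[OF assms] trace_outer_square flip: trace_eq_inner_mat_1)
  moreover have "proj_matrix (V\<^sup>\<bottom>) \<bullet> outer_square x \<ge> 0"
    by (simp add: proj_matrix_inner_outer_square subspace_orthogonal_comp)
  ultimately show ?thesis by simp
qed

lemma dim_orthogonal_comp:
  fixes W :: "(real^'d) set"
  assumes "subspace W"
  shows "dim (W\<^sup>\<bottom>) = CARD('d) - dim W"
proof -
  have "W\<^sup>\<bottom> = {y \<in> UNIV. \<forall>x\<in>W. orthogonal x y}"
    by (auto simp: orthogonal_comp_def orthogonal_commute)
  then show ?thesis
    using dim_subspace_orthogonal_to_vectors[OF assms subspace_UNIV] by simp
qed

text \<open>One-sided: the supremum of the absolute values is recovered from \<open>D\<close> and \<open>- D\<close> below.\<close>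

definition residual_sup :: "nat \<Rightarrow> real^'d^'d \<Rightarrow> real" where
  "residual_sup p D = (SUP V\<in>subspaces_of_dim p. proj_matrix (V\<^sup>\<bottom>) \<bullet> D)"

lemma subspaces_of_dim_nonempty:
  assumes "p \<le> CARD('d)"
  shows "(subspaces_of_dim p :: (real^'d) set set) \<noteq> {}"
  using choose_subspace_of_subspace[of p "UNIV :: (real^'d) set"] assms
  by (auto simp: subspaces_of_dim_def)

lemma subspaces_of_dimD:
  fixes V :: "(real^'d) set"
  assumes "V \<in> subspaces_of_dim p"
  shows "subspace V" "subspace (V\<^sup>\<bottom>)" "norm (proj_matrix V) = sqrt p"
    "norm (proj_matrix (V\<^sup>\<bottom>)) = sqrt (CARD('d) - p)"
  using assms by (auto simp: subspaces_of_dim_def norm_proj_matrix subspace_orthogonal_comp dim_orthogonal_comp)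

text \<open>Two applications of Cauchy-Schwarz.  The second is to minus the projection onto \<open>V\<close>, whose range has
  the complementary dimension, at the price of a trace term, which vanishes in expectation
  for centred \<open>D\<close>.\<close>

lemma residual_le:
  fixes D :: "real^'d^'d"
  assumes "V \<in> subspaces_of_dim p"
  shows "proj_matrix (V\<^sup>\<bottom>) \<bullet> D \<le> sqrt (CARD('d) - p) * norm D"
    and "proj_matrix (V\<^sup>\<bottom>) \<bullet> D \<le> trace D + sqrt p * norm D"
proof -
  show "proj_matrix (V\<^sup>\<bottom>) \<bullet> D \<le> sqrt (CARD('d) - p) * norm D"
    using norm_cauchy_schwarz[of "proj_matrix (V\<^sup>\<bottom>)" D] subspaces_of_dimD[OF assms] by simp
  show "proj_matrix (V\<^sup>\<bottom>) \<bullet> D \<le> trace D + sqrt p * norm D"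
    using norm_cauchy_schwarz[of "- proj_matrix V" D] subspaces_of_dimD[OF assms]
    by (simp add: proj_matrix_orthogonal_comp inner_diff_left trace_eq_inner_mat_1)
qed

lemma bdd_above_residual:
  "bdd_above ((\<lambda>V. proj_matrix (V\<^sup>\<bottom>) \<bullet> D) ` subspaces_of_dim p)"
  by (rule bdd_aboveI2) (rule residual_le(1))

lemma residual_le_sup: "V \<in> subspaces_of_dim p \<Longrightarrow> proj_matrix (V\<^sup>\<bottom>) \<bullet> D \<le> residual_sup p D"
  unfolding residual_sup_def by (intro cSUP_upper bdd_above_residual)

lemma residual_sup_le:
  fixes D :: "real^'d^'d"
  assumes "p \<le> CARD('d)"
  shows "residual_sup p D \<le> sqrt (CARD('d) - p) * norm D"
    and "residual_sup p D \<le> trace D + sqrt p * norm D"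
  unfolding residual_sup_def
  by (intro cSUP_least subspaces_of_dim_nonempty assms residual_le; assumption)+

lemma abs_residual_sup_le:
  fixes D :: "real^'d^'d"
  assumes "p \<le> CARD('d)"
  shows "\<bar>residual_sup p D\<bar> \<le> sqrt (CARD('d) - p) * norm D"
proof -
  obtain V :: "(real^'d) set" where "V \<in> subspaces_of_dim p"
    using subspaces_of_dim_nonempty[OF assms] by blast
  from residual_le(1)[OF this, of "- D"] residual_le_sup[OF this, of D] residual_sup_le(1)[OF assms, of D]
  show ?thesis by simp
qed

lemma residual_sup_diff_le:
  fixes D E :: "real^'d^'d"
  assumes p: "p \<le> CARD('d)"
    and "\<And>V :: (real^'d) set. V \<in> subspaces_of_dim p \<Longrightarrow> \<bar>proj_matrix (V\<^sup>\<bottom>) \<bullet> (D - E)\<bar> \<le> e"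
  shows "\<bar>residual_sup p D - residual_sup p E\<bar> \<le> e"
proof -
  have V: "proj_matrix (V\<^sup>\<bottom>) \<bullet> D \<le> proj_matrix (V\<^sup>\<bottom>) \<bullet> E + e"
    "proj_matrix (V\<^sup>\<bottom>) \<bullet> E \<le> proj_matrix (V\<^sup>\<bottom>) \<bullet> D + e"
    if "V \<in> subspaces_of_dim p" for V
    using assms(2)[OF that] by (auto simp: inner_diff_right abs_le_iff)
  have "residual_sup p D \<le> residual_sup p E + e"
    unfolding residual_sup_def[of _ D]
    by (intro cSUP_least subspaces_of_dim_nonempty p)
      (blast intro: order_trans[OF V(1)] add_right_mono residual_le_sup)
  moreover have "residual_sup p E \<le> residual_sup p D + e"
    unfolding residual_sup_def[of _ E]
    by (intro cSUP_least subspaces_of_dim_nonempty p)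
      (blast intro: order_trans[OF V(2)] add_right_mono residual_le_sup)
  ultimately show ?thesis by auto
qed

text \<open>A supremum of uniformly Lipschitz functions is Lipschitz.  This settles the measurability
  of the supremum over the uncountable set of subspaces.\<close>

lemma continuous_on_residual_sup:
  assumes p: "p \<le> CARD('d)"
  shows "continuous_on UNIV (residual_sup p :: real^'d^'d \<Rightarrow> real)"
proof -
  have "dist (residual_sup p D) (residual_sup p E) \<le> sqrt (CARD('d) - p) * dist D E"
    for D E :: "real^'d^'d"
    unfolding dist_real_def dist_norm
  proof (rule residual_sup_diff_le[OF p])
    fix V :: "(real^'d) set" assume "V \<in> subspaces_of_dim p"
    from residual_le(1)[OF this, of "D - E"] residual_le(1)[OF this, of "E - D"]
    show "\<bar>proj_matrix (V\<^sup>\<bottom>) \<bullet> (D - E)\<bar> \<le> sqrt (CARD('d) - p) * norm (D - E)"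
      by (auto simp: inner_diff_right abs_le_iff norm_minus_commute)
  qed
  then have "(sqrt (CARD('d) - p))-lipschitz_on UNIV (residual_sup p :: real^'d^'d \<Rightarrow> real)"
    by (intro lipschitz_onI) auto
  then show ?thesis by (rule lipschitz_on_continuous_on)
qed

lemma borel_measurable_residual_sup:
  "p \<le> CARD('d) \<Longrightarrow> (residual_sup p :: real^'d^'d \<Rightarrow> real) \<in> borel_measurable borel"
  by (intro borel_measurable_continuous_onI continuous_on_residual_sup)

lemma SUP_abs_residual:
  fixes D :: "real^'d^'d"
  assumes p: "p \<le> CARD('d)"
  shows "(SUP V\<in>subspaces_of_dim p. \<bar>proj_matrix (V\<^sup>\<bottom>) \<bullet> D\<bar>) = max (residual_sup p D) (residual_sup p (- D))"
    (is "?L = ?R")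
proof (rule antisym)
  have le: "\<bar>proj_matrix (V\<^sup>\<bottom>) \<bullet> D\<bar> \<le> ?R" if "V \<in> subspaces_of_dim p" for V
    using residual_le_sup[OF that, of D] residual_le_sup[OF that, of "- D"] by auto
  then show "?L \<le> ?R"
    by (intro cSUP_least subspaces_of_dim_nonempty p)
  have "\<bar>proj_matrix (V\<^sup>\<bottom>) \<bullet> D\<bar> \<le> ?L" if "V \<in> subspaces_of_dim p" for V
    using le that by (intro cSUP_upper bdd_aboveI2) auto
  then show "?R \<le> ?L"
    unfolding residual_sup_def
    by (intro max.boundedI cSUP_least subspaces_of_dim_nonempty p) (force simp: abs_le_iff)+
qed

section \<open>Deviations for an i.i.d. sample of fixed size\<close>

definition sample_mean :: "'i set \<Rightarrow> ('i \<Rightarrow> 'e::euclidean_space) \<Rightarrow> 'e" where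
  "sample_mean J y = (1 / real (card J)) *\<^sub>R (\<Sum>j\<in>J. y j)"

text \<open>Normalised by the sample size \<open>l\<close>, so that \<open>l / (l - 1)\<close> times this quantity is unbiased.  Applied to outer
  squares, it is the statistic \<open>S_tilde\<close>.\<close>

definition sample_variance :: "'i set \<Rightarrow> ('i \<Rightarrow> 'e::euclidean_space) \<Rightarrow> real" where
  "sample_variance J y = 1 / real (card J) * (\<Sum>j\<in>J. (norm (y j))\<^sup>2) - (norm (sample_mean J y))\<^sup>2"

lemma sample_mean_cong [cong]: "(\<And>j. j \<in> J \<Longrightarrow> x j = y j) \<Longrightarrow> sample_mean J x = sample_mean J y"
  by (simp add: sample_mean_def cong: sum.cong)

lemma sample_variance_cong [cong]:
  "(\<And>j. j \<in> J \<Longrightarrow> x j = y j) \<Longrightarrow> sample_variance J x = sample_variance J y"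
  by (simp add: sample_variance_def cong: sum.cong)

lemma sample_mean_upd_diff:
  assumes "finite J" "k \<in> J"
  shows "sample_mean J (y(k := a)) - sample_mean J y = (1 / real (card J)) *\<^sub>R (a - y k)"
proof -
  have "(\<Sum>j\<in>J. (y(k := a)) j) - (\<Sum>j\<in>J. y j) = a - y k"
    using assms by (simp add: sum.remove[of J k])
  then show ?thesis
    by (simp add: sample_mean_def flip: scaleR_diff_right)
qed

text \<open>The representation as a U-statistic: replacing one observation only affects the
  pairs that contain it.\<close>

lemma sample_variance_eq_sum_pairs:
  fixes y :: "'i \<Rightarrow> 'e::euclidean_space"
  assumes "finite J" "J \<noteq> {}"
  shows "(real (card J))\<^sup>2 * sample_variance J y = (\<Sum>i\<in>J. \<Sum>j\<in>J. (norm (y i - y j))\<^sup>2) / 2"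
proof -
  have l: "real (card J) > 0" using assms by (simp add: card_gt_0_iff)
  have "(\<Sum>i\<in>J. \<Sum>j\<in>J. (norm (y i - y j))\<^sup>2)
      = (\<Sum>i\<in>J. \<Sum>j\<in>J. (norm (y i))\<^sup>2 + (norm (y j))\<^sup>2 - 2 * (y j \<bullet> y i))"
    by (intro sum.cong refl) (simp add: power2_norm_eq_inner algebra_simps inner_commute)
  also have "\<dots> = 2 * (real (card J) * (\<Sum>j\<in>J. (norm (y j))\<^sup>2)) - 2 * (norm (\<Sum>j\<in>J. y j))\<^sup>2"
    by (simp add: sum.distrib sum_subtractf power2_norm_eq_inner inner_sum_left inner_sum_right
        sum_distrib_left)
  finally have "(\<Sum>i\<in>J. \<Sum>j\<in>J. (norm (y i - y j))\<^sup>2) / 2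
      = real (card J) * (\<Sum>j\<in>J. (norm (y j))\<^sup>2) - (norm (\<Sum>j\<in>J. y j))\<^sup>2"
    by simp
  also have "\<dots> = (real (card J))\<^sup>2 * sample_variance J y"
    using l by (simp add: sample_variance_def sample_mean_def power_divide right_diff_distrib)
      (simp add: power2_eq_square)
  finally show ?thesis by simp
qed

text \<open>Of the ordered pairs of distinct indices, \<open>2 (l - 1)\<close> contain \<open>k\<close>, and each contributes half a squared
  distance, that is, a number in \<open>[0, 1]\<close>.\<close>

lemma sample_variance_upd_diff:
  fixes y :: "'i \<Rightarrow> 'e::euclidean_space"
  assumes J: "finite J" and k: "k \<in> J"
    and a: "\<And>j. j \<in> J \<Longrightarrow> (norm (a - y j))\<^sup>2 \<le> 2"
    and y: "\<And>j. j \<in> J \<Longrightarrow> (norm (y k - y j))\<^sup>2 \<le> 2"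
  shows "\<bar>sample_variance J (y(k := a)) - sample_variance J y\<bar>
           \<le> 2 * (real (card J) - 1) / (real (card J))\<^sup>2"
proof -
  define l where "l = real (card J)"
  have ne: "J \<noteq> {}" and l: "l > 0" using k J by (auto simp: l_def card_gt_0_iff)
  have split: "l\<^sup>2 * sample_variance J z = (\<Sum>j\<in>J - {k}. (norm (z k - z j))\<^sup>2)
      + (\<Sum>i\<in>J - {k}. \<Sum>j\<in>J - {k}. (norm (z i - z j))\<^sup>2) / 2" for z :: "'i \<Rightarrow> 'e"
    unfolding l_def sample_variance_eq_sum_pairs[OF J ne] using J k
    by (simp add: sum.remove[of J k] sum.distrib norm_minus_commute[of _ "z k"])
  have "l\<^sup>2 * (sample_variance J (y(k := a)) - sample_variance J y)
      = (\<Sum>j\<in>J - {k}. (norm (a - y j))\<^sup>2 - (norm (y k - y j))\<^sup>2)"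
    by (simp add: split right_diff_distrib sum_subtractf)
  also have "\<bar>\<dots>\<bar> \<le> (\<Sum>j\<in>J - {k}. 2)"
    using a y by (intro order_trans[OF sum_abs] sum_mono) (auto simp: abs_le_iff algebra_simps intro: add_increasing2)
  also have "\<dots> = 2 * (l - 1)"
    using J k l by (simp add: l_def of_nat_diff Suc_le_eq)
  finally have "l\<^sup>2 * \<bar>sample_variance J (y(k := a)) - sample_variance J y\<bar> \<le> 2 * (l - 1)"
    by (simp add: abs_mult)
  then show ?thesis
    using l unfolding l_def[symmetric] by (subst pos_le_divide_eq) (simp_all add: mult.commute)
qed

text \<open>The observations live in an arbitrary space \<open>N\<close> and are mapped into the unit ball by \<open>h\<close>, since
  McDiarmid's inequality asks for bounded differences at every point of the product space and not
  only on the range of the observations.\<close>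

locale iid_bounded_sample = prob_space M for M :: "'a measure" +
  fixes N :: "'b measure" and X :: "'i \<Rightarrow> 'a \<Rightarrow> 'b" and J :: "'i set" and Q :: "'b measure"
    and h :: "'b \<Rightarrow> 'e::euclidean_space"
  assumes fin: "finite J" and nonempty: "J \<noteq> {}"
    and indep: "indep_vars (\<lambda>_. N) X J"
    and distr_eq: "\<And>j. j \<in> J \<Longrightarrow> distr M N (X j) = Q"
    and h [measurable]: "h \<in> borel_measurable N"
    and bounded: "\<And>x. x \<in> space N \<Longrightarrow> norm (h x) \<le> 1"
begin

text \<open>\<open>pop_var\<close> is the expected squared distance of \<open>h\<close> from its mean, in the form that appears in the
  moment computations.\<close>

definition "pop_mean = (\<integral>x. h x \<partial>Q)"
definition "pop_var = (\<integral>x. (norm (h x))\<^sup>2 \<partial>Q) - (norm pop_mean)\<^sup>2"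

lemma X [measurable]: "j \<in> J \<Longrightarrow> X j \<in> measurable M N"
  using indep by (auto simp: indep_vars_def)

lemma measurable_sample [measurable]: "(\<lambda>w. \<lambda>j\<in>J. X j w) \<in> measurable M (Pi\<^sub>M J (\<lambda>_. N))"
  by (intro measurable_restrict X)

lemma measurable_sample_mean [measurable]:
  "(\<lambda>x. sample_mean J (\<lambda>j. h (x j))) \<in> borel_measurable (Pi\<^sub>M J (\<lambda>_. N))"
  unfolding sample_mean_def by measurable

lemma measurable_sample_variance [measurable]:
  "(\<lambda>x. sample_variance J (\<lambda>j. h (x j))) \<in> borel_measurable (Pi\<^sub>M J (\<lambda>_. N))"
  unfolding sample_variance_def by measurable

lemma measurable_sample_mean_X [measurable]:
  "(\<lambda>w. sample_mean J (\<lambda>j. h (X j w))) \<in> borel_measurable M"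
  unfolding sample_mean_def by measurable

lemma bounded_X: "j \<in> J \<Longrightarrow> w \<in> space M \<Longrightarrow> norm (h (X j w)) \<le> 1"
  by (intro bounded measurable_space[OF X])

lemma integrable_bounded:
  fixes f :: "'a \<Rightarrow> 'c::euclidean_space"
  assumes "f \<in> borel_measurable M" "\<And>w. w \<in> space M \<Longrightarrow> norm (f w) \<le> B"
  shows "integrable M f"
  using assms by (intro integrable_const_bound[where B=B]) (auto intro!: AE_I2)

lemma norm_sample_mean_le: "w \<in> space M \<Longrightarrow> norm (sample_mean J (\<lambda>j. h (X j w))) \<le> 1"
proof -
  assume w: "w \<in> space M"
  have "norm (\<Sum>j\<in>J. h (X j w)) \<le> (\<Sum>j\<in>J. 1)"
    by (intro sum_norm_le bounded_X w)
  then show ?thesis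
    using fin nonempty by (simp add: sample_mean_def field_simps card_gt_0_iff)
qed

lemma integrable_h [intro]: "j \<in> J \<Longrightarrow> integrable M (\<lambda>w. h (X j w))"
  using bounded_X by (intro integrable_bounded) auto

lemma integrable_sample_mean [intro]: "integrable M (\<lambda>w. sample_mean J (\<lambda>j. h (X j w)))"
  using norm_sample_mean_le by (intro integrable_bounded) auto

lemma expectation_h: "j \<in> J \<Longrightarrow> expectation (\<lambda>w. h (X j w)) = pop_mean"
  using integral_distr[OF X h, of j] distr_eq[of j] by (simp add: pop_mean_def)

lemma expectation_norm_h: "j \<in> J \<Longrightarrow> expectation (\<lambda>w. (norm (h (X j w)))\<^sup>2) = pop_var + (norm pop_mean)\<^sup>2"
  using integral_distr[OF X, of j "\<lambda>x. (norm (h x))\<^sup>2"] distr_eq[of j] by (simp add: pop_var_def)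

lemma expectation_inner_sample_mean: "expectation (\<lambda>w. c \<bullet> sample_mean J (\<lambda>j. h (X j w))) = c \<bullet> pop_mean"
proof -
  have "expectation (\<lambda>w. sample_mean J (\<lambda>j. h (X j w)))
      = (1 / real (card J)) *\<^sub>R (\<Sum>j\<in>J. expectation (\<lambda>w. h (X j w)))"
    unfolding sample_mean_def by (simp add: integral_sum integrable_h)
  also have "\<dots> = pop_mean"
    using fin nonempty by (simp add: expectation_h sum_constant_scaleR)
  finally show ?thesis
    by (simp add: integrable_sample_mean)
qed

text \<open>Distinct observations are uncorrelated; proved coordinatewise, as independence factorises
  expectations of products of real variables.\<close>

lemma expectation_inner_h:
  assumes "i \<in> J" "j \<in> J" "i \<noteq> j"
  shows "expectation (\<lambda>w. h (X i w) \<bullet> h (X j w)) = pop_mean \<bullet> pop_mean"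
proof -
  have comp: "expectation (\<lambda>w. (h (X i w) \<bullet> b) * (h (X j w) \<bullet> b)) = (pop_mean \<bullet> b) * (pop_mean \<bullet> b)"
    and int: "integrable M (\<lambda>w. (h (X i w) \<bullet> b) * (h (X j w) \<bullet> b))" for b
  proof -
    have ind: "indep_vars (\<lambda>_. borel) (\<lambda>k w. h (X k w) \<bullet> b) {i, j}"
      by (rule indep_vars_compose2[OF indep_vars_subset[OF indep]]) (use assms in auto)
    have I: "integrable M (\<lambda>w. h (X k w) \<bullet> b)" if "k \<in> {i, j}" for k
      using that assms by auto
    have "expectation (\<lambda>w. \<Prod>k\<in>{i, j}. h (X k w) \<bullet> b) = (\<Prod>k\<in>{i, j}. expectation (\<lambda>w. h (X k w) \<bullet> b))"
      by (rule indep_vars_lebesgue_integral[OF _ ind I]) auto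
    then show "expectation (\<lambda>w. (h (X i w) \<bullet> b) * (h (X j w) \<bullet> b)) = (pop_mean \<bullet> b) * (pop_mean \<bullet> b)"
      using assms by (simp add: expectation_h integrable_h)
    show "integrable M (\<lambda>w. (h (X i w) \<bullet> b) * (h (X j w) \<bullet> b))"
      using indep_vars_integrable[OF _ ind I] assms by simp
  qed
  have "expectation (\<lambda>w. h (X i w) \<bullet> h (X j w))
      = expectation (\<lambda>w. \<Sum>b\<in>Basis. (h (X i w) \<bullet> b) * (h (X j w) \<bullet> b))"
    by (subst euclidean_inner) simp
  also have "\<dots> = (\<Sum>b\<in>Basis. (pop_mean \<bullet> b) * (pop_mean \<bullet> b))"
    by (simp add: int comp)
  also have "\<dots> = pop_mean \<bullet> pop_mean"
    by (rule euclidean_inner[symmetric])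
  finally show ?thesis .
qed

lemma expectation_norm_sample_mean:
  "expectation (\<lambda>w. (norm (sample_mean J (\<lambda>j. h (X j w))))\<^sup>2) = (norm pop_mean)\<^sup>2 + pop_var / real (card J)"
proof -
  define l where "l = real (card J)"
  have l: "l > 0" using fin nonempty by (simp add: l_def card_gt_0_iff)
  have int: "integrable M (\<lambda>w. h (X i w) \<bullet> h (X j w))" if "i \<in> J" "j \<in> J" for i j
  proof (rule integrable_bounded[where B=1])
    fix w assume w: "w \<in> space M"
    have "norm (h (X i w) \<bullet> h (X j w)) \<le> norm (h (X i w)) * norm (h (X j w))"
      by (simp add: Cauchy_Schwarz_ineq2)
    also have "\<dots> \<le> 1"
      using that w by (intro mult_le_one bounded_X) auto
    finally show "norm (h (X i w) \<bullet> h (X j w)) \<le> 1" .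
  qed (use that in measurable)
  have "(norm (sample_mean J y))\<^sup>2 = (1 / l)\<^sup>2 * ((\<Sum>i\<in>J. y i) \<bullet> (\<Sum>j\<in>J. y j))" for y :: "'i \<Rightarrow> 'e"
    by (simp add: sample_mean_def l_def power_mult_distrib power_divide dot_square_norm)
  then have sq: "(norm (sample_mean J y))\<^sup>2 = (1 / l)\<^sup>2 * (\<Sum>i\<in>J. \<Sum>j\<in>J. y i \<bullet> y j)" for y :: "'i \<Rightarrow> 'e"
    by (simp only: inner_sum_left) (simp only: inner_sum_right)
  have "expectation (\<lambda>w. (norm (sample_mean J (\<lambda>j. h (X j w))))\<^sup>2)
      = (1 / l)\<^sup>2 * (\<Sum>i\<in>J. \<Sum>j\<in>J. expectation (\<lambda>w. h (X i w) \<bullet> h (X j w)))"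
    unfolding sq using int by (simp add: integral_sum)
  also have "(\<Sum>i\<in>J. \<Sum>j\<in>J. expectation (\<lambda>w. h (X i w) \<bullet> h (X j w)))
      = (\<Sum>i\<in>J. \<Sum>j\<in>J. (norm pop_mean)\<^sup>2 + (if i = j then pop_var else 0))"
    using expectation_inner_h expectation_norm_h
    by (intro sum.cong refl) (auto simp: dot_square_norm)
  also have "\<dots> = l * (l * (norm pop_mean)\<^sup>2 + pop_var)"
    using fin by (simp add: sum.distrib l_def algebra_simps)
  also have "(1 / l)\<^sup>2 * \<dots> = (norm pop_mean)\<^sup>2 + pop_var / l"
    using l by (simp add: field_simps power2_eq_square)
  finally show ?thesis by (simp add: l_def)
qed

lemma expectation_sample_variance:
  "expectation (\<lambda>w. sample_variance J (\<lambda>j. h (X j w))) = (1 - 1 / real (card J)) * pop_var"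
proof -
  have "integrable M (\<lambda>w. (norm (h (X j w)))\<^sup>2)" if "j \<in> J" for j
    using bounded_X that by (intro integrable_bounded[where B=1]) (auto simp: power_le_one)
  moreover have "integrable M (\<lambda>w. (norm (sample_mean J (\<lambda>j. h (X j w))))\<^sup>2)"
    using norm_sample_mean_le by (intro integrable_bounded[where B=1]) (auto simp: power_le_one)
  moreover have "real (card J) \<noteq> 0" using fin nonempty by simp
  ultimately show ?thesis
    by (simp add: sample_variance_def integral_sum expectation_norm_h expectation_norm_sample_mean
        field_simps)
qed

text \<open>Jensen's inequality reduces the claim to the second moment, which is exactly the variance of a
  sample mean.\<close>

lemma expectation_norm_sample_mean_diff:
  "expectation (\<lambda>w. norm (sample_mean J (\<lambda>j. h (X j w)) - pop_mean)) \<le> sqrt (pop_var / real (card J))"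
proof -
  let ?Y = "\<lambda>w. sample_mean J (\<lambda>j. h (X j w))"
  have Y2: "integrable M (\<lambda>w. (norm (?Y w))\<^sup>2)"
    using norm_sample_mean_le by (intro integrable_bounded[where B=1]) (auto simp: power_le_one)
  have sq: "(norm (?Y w - pop_mean))\<^sup>2 = (norm (?Y w))\<^sup>2 - 2 * (pop_mean \<bullet> ?Y w) + (norm pop_mean)\<^sup>2" for w
    by (simp add: power2_norm_eq_inner algebra_simps inner_commute)
  have D: "integrable M (\<lambda>w. norm (?Y w - pop_mean))"
    by (intro integrable_norm Bochner_Integration.integrable_diff integrable_sample_mean) auto
  have D2: "integrable M (\<lambda>w. (norm (?Y w - pop_mean))\<^sup>2)"
    unfolding sq by (intro Bochner_Integration.integrable_add Bochner_Integration.integrable_diff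
        Y2 integrable_mult_right integrable_inner_right integrable_sample_mean) auto
  have "expectation (\<lambda>w. (norm (?Y w - pop_mean))\<^sup>2) = pop_var / real (card J)"
    unfolding sq using Y2
    by (simp add: integrable_sample_mean expectation_norm_sample_mean expectation_inner_sample_mean
        prob_space dot_square_norm)
  moreover have "(expectation (\<lambda>w. norm (?Y w - pop_mean)))\<^sup>2 \<le> expectation (\<lambda>w. (norm (?Y w - pop_mean))\<^sup>2)"
    using variance_positive[of "\<lambda>w. norm (?Y w - pop_mean)"] variance_eq[OF D D2] by simp
  ultimately show ?thesis
    by (intro real_le_rsqrt) simp
qed

text \<open>McDiarmid's inequality for minus the unbiased variance estimator.  If the vectors \<open>h x\<close> pairwise
  form acute or right angles, their squared distances are at most \<open>2\<close> rather than \<open>4\<close>; this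
  holds for outer squares.\<close>

lemma sample_variance_lower_tail:
  assumes l: "card J > 1" and v: "v > 0"
    and acute: "\<And>x y. x \<in> space N \<Longrightarrow> y \<in> space N \<Longrightarrow> h x \<bullet> h y \<ge> 0"
  shows "prob {w \<in> space M. sample_variance J (\<lambda>j. h (X j w)) / (1 - 1 / real (card J)) \<le> pop_var - v}
           \<le> exp (- real (card J) * v\<^sup>2 / 2)"
proof -
  define l where "l = real (card J)"
  have l: "l > 1" using l by (simp add: l_def)
  let ?f = "\<lambda>x. - (sample_variance J (\<lambda>j. h (x j)) / (1 - 1 / l))"
  have two: "(norm (h x - h y))\<^sup>2 \<le> 2" if "x \<in> space N" "y \<in> space N" for x y
  proof -
    have "(norm (h x - h y))\<^sup>2 = (norm (h x))\<^sup>2 + (norm (h y))\<^sup>2 - 2 * (h x \<bullet> h y)"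
      by (simp add: power2_norm_eq_inner algebra_simps inner_commute)
    moreover have "(norm (h x))\<^sup>2 \<le> 1" "(norm (h y))\<^sup>2 \<le> 1"
      using that bounded by (auto simp: power_le_one)
    ultimately show ?thesis using acute[OF that] by linarith
  qed
  have "prob {w \<in> space M. ?f (\<lambda>j\<in>J. X j w) \<ge> expectation (\<lambda>w. ?f (\<lambda>j\<in>J. X j w)) + v}
      \<le> exp (- 2 * v\<^sup>2 / (\<Sum>j\<in>J. (2 / l)\<^sup>2))"
  proof (rule McDiarmid_inequality[OF fin indep])
    fix x i a assume x: "x \<in> space (Pi\<^sub>M J (\<lambda>_. N))" and i: "i \<in> J" and a: "a \<in> space N"
    have xN: "x j \<in> space N" if "j \<in> J" for j
      using x that by (auto simp: space_PiM)
    have "(\<lambda>j. h ((x(i := a)) j)) = (\<lambda>j. h (x j))(i := h a)" by auto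
    then have "\<bar>sample_variance J (\<lambda>j. h ((x(i := a)) j)) - sample_variance J (\<lambda>j. h (x j))\<bar>
        \<le> 2 * (l - 1) / l\<^sup>2"
      using two xN i a by (simp only: l_def) (rule sample_variance_upd_diff[OF fin i]; simp)
    then have "\<bar>sample_variance J (\<lambda>j. h ((x(i := a)) j)) - sample_variance J (\<lambda>j. h (x j))\<bar> / (1 - 1 / l)
        \<le> 2 * (l - 1) / l\<^sup>2 / (1 - 1 / l)"
      using l by (intro divide_right_mono) auto
    then have "\<bar>?f (x(i := a)) - ?f x\<bar> \<le> 2 * (l - 1) / l\<^sup>2 / (1 - 1 / l)"
      using l by (simp only: abs_minus_commute abs_divide minus_diff_minus abs_minus_cancel
          flip: diff_divide_distrib) simp
    also have "\<dots> = 2 / l"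
      using l by (simp add: field_simps power2_eq_square)
    finally show "\<bar>?f (x(i := a)) - ?f x\<bar> \<le> 2 / l" .
  next
    show "?f \<in> borel_measurable (Pi\<^sub>M J (\<lambda>_. N))" by measurable
  qed (use v l fin nonempty in \<open>auto simp: zero_less_mult_iff card_gt_0_iff\<close>)
  also have "expectation (\<lambda>w. ?f (\<lambda>j\<in>J. X j w)) = - pop_var"
    using l by (simp add: expectation_sample_variance l_def)
  also have "- 2 * v\<^sup>2 / (\<Sum>j\<in>J. (2 / l)\<^sup>2) = - l * v\<^sup>2 / 2"
    using l by (simp add: l_def field_simps power2_eq_square)
  finally show ?thesis
    by (simp add: l_def algebra_simps)
qed

end

text \<open>The sign \<open>s\<close> covers both one-sided suprema.  The expectation of each is bounded by the two
  inequalities for \<open>residual_sup\<close>, with the trace centred, and McDiarmid's inequality controls the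
  fluctuation around it.\<close>

lemma residual_sup_sample_mean_upper_tail:
  fixes g :: "'b \<Rightarrow> real^'d" and s :: real
  assumes "iid_bounded_sample M N X J Q (\<lambda>x. outer_square (g x))"
    and g: "\<And>x. x \<in> space N \<Longrightarrow> norm (g x) \<le> 1"
    and p: "p \<le> CARD('d)" and u: "u > 0" and s: "\<bar>s\<bar> = 1"
  defines "\<mu> \<equiv> iid_bounded_sample.pop_mean Q (\<lambda>x. outer_square (g x))"
    and "\<sigma> \<equiv> iid_bounded_sample.pop_var Q (\<lambda>x. outer_square (g x))"
  defines "\<Delta> \<equiv> (\<lambda>w. s *\<^sub>R (sample_mean J (\<lambda>j. outer_square (g (X j w))) - \<mu>))"
  shows "measure M {w \<in> space M. residual_sup p (\<Delta> w)
           \<ge> sqrt (real (min p (CARD('d) - p)) * (\<sigma> / real (card J))) + u}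
         \<le> exp (- 2 * real (card J) * u\<^sup>2)"
proof -
  interpret iid_bounded_sample M N X J Q "\<lambda>x. outer_square (g x)" by fact
  define l where "l = real (card J)"
  have l: "l > 0" using fin nonempty by (simp add: l_def card_gt_0_iff)
  have [measurable]: "(residual_sup p :: real^'d^'d \<Rightarrow> real) \<in> borel_measurable borel"
    by (rule borel_measurable_residual_sup[OF p])
  let ?f = "\<lambda>x. residual_sup p (s *\<^sub>R (sample_mean J (\<lambda>j. outer_square (g (x j))) - \<mu>))"
  have f: "?f \<in> borel_measurable (Pi\<^sub>M J (\<lambda>_. N))" by measurable
  have \<Delta>: "integrable M \<Delta>" "norm (\<Delta> w) = norm (sample_mean J (\<lambda>j. outer_square (g (X j w))) - \<mu>)" for w
    unfolding \<Delta>_def using s integrable_sample_mean by auto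
  have norm_\<Delta>: "expectation (\<lambda>w. norm (\<Delta> w)) \<le> sqrt (\<sigma> / l)"
    unfolding \<Delta>(2) using expectation_norm_sample_mean_diff by (simp add: \<mu>_def \<sigma>_def l_def)
  have trace_\<Delta>: "expectation (\<lambda>w. trace (\<Delta> w)) = 0"
    by (simp add: trace_eq_inner_mat_1 \<Delta>_def inner_diff_right expectation_inner_sample_mean
        integrable_sample_mean prob_space \<mu>_def)
  have int_trace: "integrable M (\<lambda>w. trace (\<Delta> w))"
    unfolding trace_eq_inner_mat_1 by (intro integrable_inner_right \<Delta>(1))
  have int_f: "integrable M (\<lambda>w. residual_sup p (\<Delta> w))"
  proof (rule Bochner_Integration.integrable_bound)
    show "integrable M (\<lambda>w. sqrt (CARD('d) - p) * norm (\<Delta> w))"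
      by (intro integrable_mult_right integrable_norm \<Delta>(1))
    show "(\<lambda>w. residual_sup p (\<Delta> w)) \<in> borel_measurable M"
      using borel_measurable_integrable[OF \<Delta>(1)] by measurable
    show "AE w in M. norm (residual_sup p (\<Delta> w)) \<le> norm (sqrt (CARD('d) - p) * norm (\<Delta> w))"
      using abs_residual_sup_le[OF p] by (auto intro!: AE_I2 simp: abs_mult)
  qed
  define e where "e = expectation (\<lambda>w. residual_sup p (\<Delta> w))"
  have "e \<le> expectation (\<lambda>w. sqrt (CARD('d) - p) * norm (\<Delta> w))"
    unfolding e_def by (intro integral_mono int_f integrable_mult_right integrable_norm \<Delta>(1)
        residual_sup_le p)
  then have "e \<le> sqrt (CARD('d) - p) * expectation (\<lambda>w. norm (\<Delta> w))"
    by simp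
  also have "\<dots> \<le> sqrt (CARD('d) - p) * sqrt (\<sigma> / l)"
    by (intro mult_left_mono norm_\<Delta>) simp
  finally have e1: "e \<le> sqrt (real (CARD('d) - p) * (\<sigma> / l))"
    by (simp only: real_sqrt_mult)
  have "e \<le> expectation (\<lambda>w. trace (\<Delta> w) + sqrt p * norm (\<Delta> w))"
    unfolding e_def by (intro integral_mono int_f Bochner_Integration.integrable_add int_trace
        integrable_mult_right integrable_norm \<Delta>(1) residual_sup_le p)
  also have "\<dots> = sqrt p * expectation (\<lambda>w. norm (\<Delta> w))"
    using int_trace \<Delta>(1) by (simp add: trace_\<Delta>)
  also have "\<dots> \<le> sqrt p * sqrt (\<sigma> / l)"
    by (intro mult_left_mono norm_\<Delta>) simp
  finally have e2: "e \<le> sqrt (real p * (\<sigma> / l))"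
    by (simp only: real_sqrt_mult)
  have e: "e \<le> sqrt (real (min p (CARD('d) - p)) * (\<sigma> / l))"
    using e1 e2 by (simp add: min_def)
  have "prob {w \<in> space M. ?f (\<lambda>j\<in>J. X j w) \<ge> expectation (\<lambda>w. ?f (\<lambda>j\<in>J. X j w)) + u}
      \<le> exp (- 2 * u\<^sup>2 / (\<Sum>j\<in>J. (1 / l)\<^sup>2))"
  proof (rule McDiarmid_inequality[OF fin indep f])
    fix x i a assume x: "x \<in> space (Pi\<^sub>M J (\<lambda>_. N))" and i: "i \<in> J" and a: "a \<in> space N"
    have xi: "x i \<in> space N"
      using x i by (auto simp: space_PiM)
    have eq: "(\<lambda>j. outer_square (g ((x(i := a)) j))) = (\<lambda>j. outer_square (g (x j)))(i := outer_square (g a))"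
      by auto
    show "\<bar>?f (x(i := a)) - ?f x\<bar> \<le> 1 / l"
    proof (rule residual_sup_diff_le[OF p])
      fix V :: "(real^'d) set" assume "V \<in> subspaces_of_dim p"
      then have V: "subspace V" by (simp add: subspaces_of_dimD)
      let ?P = "\<lambda>y. proj_matrix (V\<^sup>\<bottom>) \<bullet> outer_square (g y)"
      have P: "?P y \<in> {0..1}" if "y \<in> space N" for y
        using residual_outer_square[OF V, of "g y"] power_le_one[OF norm_ge_zero g[OF that], of 2] by auto
      have "s *\<^sub>R (sample_mean J (\<lambda>j. outer_square (g ((x(i := a)) j))) - \<mu>)
          - s *\<^sub>R (sample_mean J (\<lambda>j. outer_square (g (x j))) - \<mu>)
          = s *\<^sub>R (sample_mean J (\<lambda>j. outer_square (g ((x(i := a)) j)))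
              - sample_mean J (\<lambda>j. outer_square (g (x j))))"
        by (simp add: algebra_simps)
      also have "\<dots> = s *\<^sub>R ((1 / l) *\<^sub>R (outer_square (g a) - outer_square (g (x i))))"
        unfolding eq l_def sample_mean_upd_diff[OF fin i] by (rule refl)
      also have "\<bar>proj_matrix (V\<^sup>\<bottom>) \<bullet> \<dots>\<bar> = \<bar>?P a - ?P (x i)\<bar> / l"
        using s l by (simp add: abs_mult inner_diff_right)
      also have "\<dots> \<le> 1 / l"
        using P[OF a] P[OF xi] l by (intro divide_right_mono) auto
      finally show "\<bar>proj_matrix (V\<^sup>\<bottom>) \<bullet> (s *\<^sub>R (sample_mean J (\<lambda>j. outer_square (g ((x(i := a)) j))) - \<mu>)
          - s *\<^sub>R (sample_mean J (\<lambda>j. outer_square (g (x j))) - \<mu>))\<bar> \<le> 1 / l" .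
    qed
  qed (use u l fin nonempty in \<open>auto simp: zero_less_mult_iff card_gt_0_iff\<close>)
  also have "- 2 * u\<^sup>2 / (\<Sum>j\<in>J. (1 / l)\<^sup>2) = - 2 * l * u\<^sup>2"
    using l by (simp add: l_def field_simps power2_eq_square)
  also have "expectation (\<lambda>w. ?f (\<lambda>j\<in>J. X j w)) = e"
    by (simp add: e_def \<Delta>_def)
  finally have tail: "prob {w \<in> space M. ?f (\<lambda>j\<in>J. X j w) \<ge> e + u} \<le> exp (- 2 * l * u\<^sup>2)" .
  have "prob {w \<in> space M. residual_sup p (\<Delta> w) \<ge> sqrt (real (min p (CARD('d) - p)) * (\<sigma> / l)) + u}
      \<le> prob {w \<in> space M. ?f (\<lambda>j\<in>J. X j w) \<ge> e + u}"
  proof (rule finite_measure_mono)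
    show "{w \<in> space M. ?f (\<lambda>j\<in>J. X j w) \<ge> e + u} \<in> events"
      using measurable_compose[OF measurable_sample f] by measurable
  qed (use e in \<open>auto simp: \<Delta>_def\<close>)
  with tail show ?thesis by (simp add: l_def)
qed

text \<open>Outside three exceptional events, both one-sided suprema are close to their expectation bound
  and the variance estimator is not much smaller than the variance, so the variance in that bound
  may be replaced by its estimator.\<close>

theorem uniform_residual_deviation:
  fixes g :: "'b \<Rightarrow> real^'d"
  assumes iid: "iid_bounded_sample M N X J Q (\<lambda>x. outer_square (g x))"
    and g: "\<And>x. x \<in> space N \<Longrightarrow> norm (g x) \<le> 1"
    and p: "p \<le> CARD('d)" and l: "card J > 1" and u: "u > 0" and v: "v > 0"
  defines "\<mu> \<equiv> iid_bounded_sample.pop_mean Q (\<lambda>x. outer_square (g x))"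
  defines "Y \<equiv> (\<lambda>w j. outer_square (g (X j w)))"
  shows "measure M {w \<in> space M.
           (SUP V\<in>subspaces_of_dim p. \<bar>proj_matrix (V\<^sup>\<bottom>) \<bullet> (sample_mean J (Y w) - \<mu>)\<bar>)
           \<ge> sqrt (real (min p (CARD('d) - p))
                     * (sample_variance J (Y w) / (real (card J) - 1) + v / real (card J))) + u}
         \<le> 2 * exp (- 2 * real (card J) * u\<^sup>2) + exp (- real (card J) * v\<^sup>2 / 2)"
proof -
  interpret iid_bounded_sample M N X J Q "\<lambda>x. outer_square (g x)" by (fact iid)
  define n where "n = real (card J)"
  have n: "n > 1" using l by (simp add: n_def)
  define k where "k = real (min p (CARD('d) - p))"
  have k: "k \<ge> 0" by (simp add: k_def)
  have [measurable]: "(residual_sup p :: real^'d^'d \<Rightarrow> real) \<in> borel_measurable borel"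
    by (rule borel_measurable_residual_sup[OF p])
  have [measurable]: "(\<lambda>w. sample_mean J (Y w)) \<in> borel_measurable M"
    "(\<lambda>w. sample_variance J (Y w)) \<in> borel_measurable M"
    unfolding Y_def sample_variance_def by measurable
  define E where "E s = {w \<in> space M. residual_sup p (s *\<^sub>R (sample_mean J (Y w) - \<mu>))
      \<ge> sqrt (k * (pop_var / n)) + u}" for s :: real
  define F where "F = {w \<in> space M. sample_variance J (Y w) / (1 - 1 / n) \<le> pop_var - v}"
  have meas [measurable]: "E s \<in> events" "F \<in> events" for s
    unfolding E_def F_def by measurable
  have E: "prob (E s) \<le> exp (- 2 * n * u\<^sup>2)" if "\<bar>s\<bar> = 1" for s
    using residual_sup_sample_mean_upper_tail[OF iid g p u that]
    by (simp add: E_def \<mu>_def n_def Y_def k_def)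
  have F: "prob F \<le> exp (- n * v\<^sup>2 / 2)"
    using sample_variance_lower_tail[OF l v] by (simp add: F_def n_def Y_def inner_outer_square)
  have "{w \<in> space M. (SUP V\<in>subspaces_of_dim p. \<bar>proj_matrix (V\<^sup>\<bottom>) \<bullet> (sample_mean J (Y w) - \<mu>)\<bar>)
           \<ge> sqrt (k * (sample_variance J (Y w) / (n - 1) + v / n)) + u} \<subseteq> E 1 \<union> E (- 1) \<union> F"
  proof safe
    fix w assume w: "w \<in> space M" "w \<notin> F" "w \<notin> E (- 1)"
      and ge: "sqrt (k * (sample_variance J (Y w) / (n - 1) + v / n)) + u
        \<le> (SUP V\<in>subspaces_of_dim p. \<bar>proj_matrix (V\<^sup>\<bottom>) \<bullet> (sample_mean J (Y w) - \<mu>)\<bar>)"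
    have "pop_var / n \<le> (sample_variance J (Y w) / (1 - 1 / n) + v) / n"
      using w(1,2) n by (intro divide_right_mono) (auto simp: F_def)
    also have "\<dots> = sample_variance J (Y w) / (n - 1) + v / n"
      using n by (simp add: field_simps)
    finally have "sqrt (k * (pop_var / n)) \<le> sqrt (k * (sample_variance J (Y w) / (n - 1) + v / n))"
      using k by (intro real_sqrt_le_mono mult_left_mono)
    with ge have "sqrt (k * (pop_var / n)) + u
        \<le> max (residual_sup p (sample_mean J (Y w) - \<mu>)) (residual_sup p (- (sample_mean J (Y w) - \<mu>)))"
      unfolding SUP_abs_residual[OF p] by linarith
    with w(1,3) show "w \<in> E 1"
      unfolding le_max_iff_disj by (auto simp: E_def)
  qed
  then have "prob {w \<in> space M. (SUP V\<in>subspaces_of_dim p. \<bar>proj_matrix (V\<^sup>\<bottom>) \<bullet> (sample_mean J (Y w) - \<mu>)\<bar>)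
           \<ge> sqrt (k * (sample_variance J (Y w) / (n - 1) + v / n)) + u} \<le> prob (E 1 \<union> E (- 1) \<union> F)"
    by (intro finite_measure_mono) auto
  also have "\<dots> \<le> prob (E 1) + prob (E (- 1)) + prob F"
    using measure_Un_le[of "E 1 \<union> E (- 1)" M F] measure_Un_le[of "E 1" M "E (- 1)"]
      meas by auto
  also have "\<dots> \<le> 2 * exp (- 2 * n * u\<^sup>2) + exp (- n * v\<^sup>2 / 2)"
    using E[of 1] E[of "- 1"] F by simp
  finally show ?thesis by (simp add: n_def k_def)
qed

section \<open>Conditioning on a rectangle\<close>

lemma (in prob_space) prob_rectangle:
  assumes indep: "indep_vars N X I" and "finite I" and C: "\<And>i. i \<in> I \<Longrightarrow> C i \<in> sets (N i)"
  shows "prob {w \<in> space M. \<forall>i\<in>I. X i w \<in> C i} = (\<Prod>i\<in>I. prob {w \<in> space M. X i w \<in> C i})"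
proof (cases "I = {}")
  case False
  have vimage: "{w \<in> space M. X i w \<in> C i} = X i -` C i \<inter> space M" for i
    by auto
  have "{w \<in> space M. \<forall>i\<in>I. X i w \<in> C i} = (\<Inter>i\<in>I. X i -` C i \<inter> space M)"
    using False by auto
  then show ?thesis
    using indep_varsD[OF indep False \<open>finite I\<close> subset_refl C] by (simp add: vimage)
qed (simp add: prob_space)

text \<open>Conditioning independent variables on a rectangle keeps them independent, because the factors of
  coordinates that an event does not mention cancel in the conditional probability.\<close>

lemma (in prob_space)
  assumes indep: "indep_vars N X I" and fin: "finite I" and A: "\<And>i. i \<in> I \<Longrightarrow> A i \<in> sets (N i)"
  defines "E \<equiv> {w \<in> space M. \<forall>i\<in>I. X i w \<in> A i}"
  assumes pos: "prob E \<noteq> 0"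
  shows prob_space_conditioned_on_rectangle: "prob_space (uniform_measure M E)"
    and measure_conditioned_on_rectangle:
      "\<And>i B. i \<in> I \<Longrightarrow> B \<in> sets (N i) \<Longrightarrow>
        measure (uniform_measure M E) {w \<in> space M. X i w \<in> B}
          = prob {w \<in> space M. X i w \<in> A i \<inter> B} / prob {w \<in> space M. X i w \<in> A i}"
    and indep_vars_conditioned_on_rectangle: "prob_space.indep_vars (uniform_measure M E) N X I"
proof -
  have rv [measurable]: "X i \<in> measurable M (N i)" if "i \<in> I" for i
    using indep that by (auto simp: indep_vars_def)
  have ev: "{w \<in> space M. X i w \<in> B} \<in> events" if "i \<in> I" "B \<in> sets (N i)" for i B
    using measurable_sets[OF rv[OF that(1)] that(2)] by (simp add: vimage_def Int_def conj_commute)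
  have E [measurable]: "E \<in> events"
    unfolding E_def using fin A by (intro sets.sets_Collect_finite_All ev)
  interpret U: prob_space "uniform_measure M E"
    using pos E by (intro prob_space_uniform_measure) (auto simp: emeasure_eq_measure)
  show "prob_space (uniform_measure M E)" by (rule U.prob_space_axioms)
  let ?p = "\<lambda>i. prob {w \<in> space M. X i w \<in> A i}"
  let ?q = "\<lambda>i B. prob {w \<in> space M. X i w \<in> A i \<inter> B}"
  have prob_E: "prob E = (\<Prod>i\<in>I. ?p i)"
    unfolding E_def by (rule prob_rectangle[OF indep fin A])
  have p: "?p i \<noteq> 0" if "i \<in> I" for i
    using pos prob_E fin that by auto
  have cond: "measure (uniform_measure M E) {w \<in> space M. \<forall>i\<in>L. X i w \<in> B i} = (\<Prod>i\<in>L. ?q i (B i) / ?p i)"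
    if L: "L \<subseteq> I" and B: "\<And>i. i \<in> L \<Longrightarrow> B i \<in> sets (N i)" for L B
  proof -
    have finL: "finite L" using L fin by (rule finite_subset)
    have R [measurable]: "{w \<in> space M. \<forall>i\<in>L. X i w \<in> B i} \<in> events"
      using finL L B by (intro sets.sets_Collect_finite_All ev) auto
    define C where "C i = (if i \<in> L then A i \<inter> B i else A i)" for i
    have "E \<inter> {w \<in> space M. \<forall>i\<in>L. X i w \<in> B i} = {w \<in> space M. \<forall>i\<in>I. X i w \<in> C i}"
      using L by (auto simp: E_def C_def)
    then have "prob (E \<inter> {w \<in> space M. \<forall>i\<in>L. X i w \<in> B i}) = (\<Prod>i\<in>I. prob {w \<in> space M. X i w \<in> C i})"
      using A B by (simp only:) (rule prob_rectangle[OF indep fin], auto simp: C_def)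
    also have "\<dots> = (\<Prod>i\<in>I - L. ?p i) * (\<Prod>i\<in>L. ?q i (B i))"
      unfolding prod.subset_diff[OF L fin] by (intro arg_cong2[where f="(*)"] prod.cong) (auto simp: C_def)
    finally have num: "prob (E \<inter> {w \<in> space M. \<forall>i\<in>L. X i w \<in> B i}) = \<dots>" .
    have "prob E = (\<Prod>i\<in>I - L. ?p i) * (\<Prod>i\<in>L. ?p i)"
      unfolding prob_E by (rule prod.subset_diff[OF L fin])
    moreover have "(\<Prod>i\<in>I - L. ?p i) \<noteq> 0"
      using p fin by auto
    ultimately have "prob (E \<inter> {w \<in> space M. \<forall>i\<in>L. X i w \<in> B i}) / prob E = (\<Prod>i\<in>L. ?q i (B i) / ?p i)"
      by (simp add: num prod_dividef)
    then show ?thesis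
      using R pos by (subst measure_uniform_measure) (auto simp: emeasure_eq_measure)
  qed
  show single: "measure (uniform_measure M E) {w \<in> space M. X i w \<in> B} = ?q i B / ?p i"
    if "i \<in> I" "B \<in> sets (N i)" for i B
    using cond[of "{i}" "\<lambda>_. B"] that by simp
  show "U.indep_vars N X I"
    unfolding U.indep_vars_def2
  proof (intro conjI ballI U.indep_setsI)
    show "X i \<in> measurable (uniform_measure M E) (N i)" if "i \<in> I" for i
      using that by simp
    show "{X i -` B \<inter> space (uniform_measure M E) |B. B \<in> sets (N i)} \<subseteq> U.events" if "i \<in> I" for i
      using that by (auto intro: measurable_sets)
  next
    fix S L assume L: "L \<noteq> {}" "L \<subseteq> I" "finite L"
      and "\<forall>j\<in>L. S j \<in> {X j -` B \<inter> space (uniform_measure M E) |B. B \<in> sets (N j)}"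
    then have "\<forall>j\<in>L. \<exists>B. B \<in> sets (N j) \<and> S j = X j -` B \<inter> space M"
      by auto
    then obtain B where B: "\<And>j. j \<in> L \<Longrightarrow> B j \<in> sets (N j)"
      "\<And>j. j \<in> L \<Longrightarrow> S j = {w \<in> space M. X j w \<in> B j}"
      unfolding bchoice_iff by (auto simp: vimage_def Int_def conj_commute)
    have "(\<Inter>j\<in>L. S j) = {w \<in> space M. \<forall>j\<in>L. X j w \<in> B j}"
      using L(1) B(2) by auto
    moreover have "(\<Prod>j\<in>L. ?q j (B j) / ?p j) = (\<Prod>j\<in>L. measure (uniform_measure M E) (S j))"
      using single B L(2) by (intro prod.cong) auto
    ultimately show "measure (uniform_measure M E) (\<Inter>j\<in>L. S j) = (\<Prod>j\<in>L. measure (uniform_measure M E) (S j))"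
      using cond[OF L(2) B(1)] by simp
  qed
qed

section \<open>Risks as linear functionals of moment matrices\<close>

definition exceedances :: "nat \<Rightarrow> real \<Rightarrow> (nat \<Rightarrow> real^'d) \<Rightarrow> nat set" where
  "exceedances n t x = {i \<in> {1..n}. norm (x i) > t}"

lemma num_exc_eq_card: "num_exc n t x = card (exceedances n t x)"
proof -
  have "num_exc n t x = (\<Sum>i\<in>{1..n}. if norm (x i) > t then 1 else 0)"
    unfolding num_exc_def by (intro sum.cong) auto
  also have "\<dots> = card (exceedances n t x)"
    by (simp add: sum.If_cases exceedances_def Int_def)
  finally show ?thesis .
qed

text \<open>Observations below the threshold are mapped to zero, so sums over the sample are sums
  over the exceedances.\<close>

lemma sum_theta_exc:
  assumes "f 0 = 0"
  shows "(\<Sum>i=1..n. f (theta_exc \<omega> t (x i))) = (\<Sum>i\<in>exceedances n t x. f (theta_exc \<omega> t (x i)))"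
  using assms by (intro sum.mono_neutral_right) (auto simp: exceedances_def theta_exc_def)

lemma outer_square_0 [simp]: "outer_square 0 = 0"
  by (simp add: outer_square_def vec_eq_iff)

lemma emp_moment_matrix_eq_sample_mean:
  "emp_moment_matrix \<omega> n t x = sample_mean (exceedances n t x) (\<lambda>i. outer_square (theta_exc \<omega> t (x i)))"
  using sum_theta_exc[of outer_square \<omega> t x n]
  by (simp add: emp_moment_matrix_def sample_mean_def num_exc_eq_card)

lemma emp_risk_eq_inner:
  fixes V :: "(real^'d) set"
  assumes "subspace V"
  shows "emp_risk \<omega> n t x V = proj_matrix (V\<^sup>\<bottom>) \<bullet> emp_moment_matrix \<omega> n t x"
  by (simp add: emp_risk_def emp_moment_matrix_def inner_sum_right
      proj_matrix_inner_outer_square[OF subspace_orthogonal_comp])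

lemma transpose_emp_moment_matrix: "transpose (emp_moment_matrix \<omega> n t x) = emp_moment_matrix \<omega> n t x"
  by (simp add: emp_moment_matrix_def outer_square_def transpose_def vec_eq_iff sum_component mult.commute)

lemma trace_square_symmetric:
  assumes "transpose A = (A :: real^'d^'d)"
  shows "trace (A ** A) = (norm A)\<^sup>2"
proof -
  have "A $ i $ j = A $ j $ i" for i j
    using assms by (metis transpose_def vec_lambda_beta)
  then have "trace (A ** A) = (\<Sum>i\<in>UNIV. \<Sum>j\<in>UNIV. A $ i $ j * A $ i $ j)"
    by (simp add: trace_def matrix_matrix_mult_def)
  then show ?thesis
    by (simp add: power2_norm_eq_inner inner_vec_def)
qed

lemma S_tilde_eq_sample_variance:
  "S_tilde \<omega> n t x = sample_variance (exceedances n t x) (\<lambda>i. outer_square (theta_exc \<omega> t (x i)))"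
  using sum_theta_exc[of "\<lambda>y. norm y ^ 4" \<omega> t x n]
  by (simp add: S_tilde_def sample_variance_def trace_square_symmetric transpose_emp_moment_matrix
      emp_moment_matrix_eq_sample_mean[symmetric] norm_outer_square num_exc_eq_card)

lemma norm_theta_exc_le:
  assumes "\<And>x. x \<noteq> 0 \<Longrightarrow> \<omega> x > 0" "\<And>x. x \<noteq> 0 \<Longrightarrow> \<omega> x \<le> 1 / norm x"
  shows "norm (theta_exc \<omega> t x) \<le> 1"
  using assms(1)[of x] assms(2)[of x]
  by (auto simp: theta_exc_def theta_def field_simps)

lemma borel_measurable_theta:
  fixes \<omega> :: "real^'d \<Rightarrow> real"
  assumes "\<omega> \<in> borel_measurable (restrict_space borel (- {0}))"
  shows "theta \<omega> \<in> borel_measurable borel"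
proof -
  have [measurable]: "(\<lambda>x. if x \<in> - {0} then \<omega> x else 0) \<in> borel_measurable borel"
    using assms by (subst (asm) measurable_restrict_space_iff[where c=0]) auto
  have "theta \<omega> = (\<lambda>x. (if x \<in> - {0} then \<omega> x else 0) *\<^sub>R x)"
    by (auto simp: theta_def)
  also have "\<dots> \<in> borel_measurable borel" by measurable
  finally show ?thesis .
qed

lemma borel_measurable_theta_exc:
  assumes [measurable]: "theta \<omega> \<in> borel_measurable borel"
  shows "theta_exc \<omega> t \<in> borel_measurable borel"
  unfolding theta_exc_def[abs_def] by measurable

lemma borel_measurable_outer_square: "outer_square \<in> borel_measurable borel"
  unfolding outer_square_def
  by (intro borel_measurable_continuous_onI continuous_intros)

definition exceedance_law :: "'a measure \<Rightarrow> ('a \<Rightarrow> real^'d) \<Rightarrow> real \<Rightarrow> (real^'d) measure" where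
  "exceedance_law M X t = distr (uniform_measure M {w \<in> space M. norm (X w) > t}) borel X"

definition moment_matrix :: "'a measure \<Rightarrow> (real^'d \<Rightarrow> real) \<Rightarrow> ('a \<Rightarrow> real^'d) \<Rightarrow> real \<Rightarrow> real^'d^'d" where
  "moment_matrix M \<omega> X t = (\<integral>x. outer_square (theta_exc \<omega> t x) \<partial>exceedance_law M X t)"

text \<open>On the conditioning event, \<open>theta\<close> and \<open>theta_exc\<close> agree.  The latter is bounded everywhere, so its
  outer square is integrable and the inner product can be pulled out of the integral.  If the
  conditioning event is null, the conditional measure is zero and both sides vanish.\<close>

lemma true_risk_eq_inner:
  fixes X :: "'a \<Rightarrow> real^'d"
  assumes "prob_space M" and X [measurable]: "X \<in> borel_measurable M"
    and theta [measurable]: "theta \<omega> \<in> borel_measurable borel"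
    and bound: "\<And>x. norm (theta_exc \<omega> t x) \<le> 1"
    and V: "subspace V"
  shows "true_risk M \<omega> X t V = proj_matrix (V\<^sup>\<bottom>) \<bullet> moment_matrix M \<omega> X t"
proof -
  interpret prob_space M by fact
  let ?A = "{w \<in> space M. norm (X w) > t}"
  let ?U = "uniform_measure M ?A"
  have A: "?A \<in> events" by measurable
  have "emeasure ?U (space ?U) = emeasure M ?A / emeasure M ?A"
    using A by (simp add: Int_absorb2 sets.sets_into_space)
  then interpret U: finite_measure ?U
    by (intro finite_measureI) (auto simp: emeasure_eq_measure divide_ennreal_def ennreal_mult_eq_top_iff)
  note borel_measurable_outer_square [measurable] borel_measurable_theta_exc [measurable]
  have int: "integrable ?U (\<lambda>w. outer_square (theta_exc \<omega> t (X w)))"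
    using bound by (intro U.integrable_const_bound[where B=1])
      (auto simp: norm_outer_square power_le_one intro!: AE_I2)
  have "true_risk M \<omega> X t V = (\<integral>w. proj_matrix (V\<^sup>\<bottom>) \<bullet> outer_square (theta_exc \<omega> t (X w)) \<partial>?U)"
    unfolding true_risk_def
  proof (rule integral_cong_AE)
    show "AE w in ?U. (norm (orth_proj (V\<^sup>\<bottom>) (theta \<omega> (X w))))\<^sup>2
        = proj_matrix (V\<^sup>\<bottom>) \<bullet> outer_square (theta_exc \<omega> t (X w))"
      using A by (intro AE_uniform_measureI AE_I2)
        (auto simp: theta_exc_def proj_matrix_inner_outer_square subspace_orthogonal_comp)
    have "(\<lambda>w. proj_matrix (V\<^sup>\<bottom>) \<bullet> outer_square (theta \<omega> (X w))) \<in> borel_measurable ?U"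
      by measurable
    then show "(\<lambda>w. (norm (orth_proj (V\<^sup>\<bottom>) (theta \<omega> (X w))))\<^sup>2) \<in> borel_measurable ?U"
      by (simp only: proj_matrix_inner_outer_square[OF subspace_orthogonal_comp])
  qed measurable
  also have "\<dots> = proj_matrix (V\<^sup>\<bottom>) \<bullet> (\<integral>w. outer_square (theta_exc \<omega> t (X w)) \<partial>?U)"
    using int by simp
  also have "(\<integral>w. outer_square (theta_exc \<omega> t (X w)) \<partial>?U) = moment_matrix M \<omega> X t"
    unfolding moment_matrix_def exceedance_law_def by (rule integral_distr[symmetric]) measurable
  finally show ?thesis .
qed

section \<open>Deviations given the number of exceedances\<close>

locale exceedance_sample = prob_space M for M :: "'a measure" +
  fixes X :: "'a \<Rightarrow> real^'d" and Xs :: "nat \<Rightarrow> 'a \<Rightarrow> real^'d" and \<omega> :: "real^'d \<Rightarrow> real"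
    and n p :: nat and t :: real
  assumes X [measurable]: "X \<in> borel_measurable M"
    and indep: "indep_vars (\<lambda>_. borel) Xs {1..n}"
    and distr: "\<And>i. i \<in> {1..n} \<Longrightarrow> distr M borel (Xs i) = distr M borel X"
    and \<omega>_measurable: "\<omega> \<in> borel_measurable (restrict_space borel (- {0}))"
    and \<omega>_pos: "\<And>x. x \<noteq> 0 \<Longrightarrow> \<omega> x > 0"
    and \<omega>_le: "\<And>x. x \<noteq> 0 \<Longrightarrow> \<omega> x \<le> 1 / norm x"
    and p: "p \<le> CARD('d)"
begin

lemma theta_measurable [measurable]:
  "theta \<omega> \<in> borel_measurable borel" "theta_exc \<omega> t \<in> borel_measurable borel"
  using \<omega>_measurable by (auto intro: borel_measurable_theta borel_measurable_theta_exc)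

lemma norm_theta_exc: "norm (theta_exc \<omega> t x) \<le> 1"
  using \<omega>_pos \<omega>_le by (rule norm_theta_exc_le)

lemma Xs [measurable]: "i \<in> {1..n} \<Longrightarrow> Xs i \<in> borel_measurable M"
  using indep by (auto simp: indep_vars_def)

lemma prob_Xs:
  assumes "i \<in> {1..n}" and B: "B \<in> sets borel"
  shows "prob {w \<in> space M. Xs i w \<in> B} = prob {w \<in> space M. X w \<in> B}"
proof -
  have "measure (distr M borel (Xs i)) B = measure (distr M borel X) B"
    using distr[OF assms(1)] by simp
  then show ?thesis
    using assms by (simp add: measure_distr vimage_def Int_def conj_commute)
qed

definition "Mhat w = emp_moment_matrix \<omega> n t (\<lambda>i. Xs i w)"
definition "\<mu> = moment_matrix M \<omega> X t"
definition "radius l u v w = band_radius \<omega> p n t l u v (\<lambda>i. Xs i w)"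
text \<open>By \<open>risk_diff\<close> below, the largest absolute deviation of the empirical from the true risk.\<close>

definition "sup_dev w = (SUP V\<in>subspaces_of_dim p. \<bar>proj_matrix (V\<^sup>\<bottom>) \<bullet> (Mhat w - \<mu>)\<bar>)"
definition "N w = num_exc n t (\<lambda>i. Xs i w)"
definition "pattern J = {w \<in> space M. exceedances n t (\<lambda>i. Xs i w) = J}"

lemma N_measurable [measurable]: "N \<in> measurable M (count_space UNIV)"
proof -
  have "N = (\<lambda>w. \<Sum>i\<in>{1..n}. if norm (Xs i w) > t then 1 else 0)"
    unfolding N_def num_exc_def by (intro ext sum.cong) auto
  then show ?thesis by simp
qed

lemma Mhat_measurable [measurable]: "Mhat \<in> borel_measurable M"
proof -
  note borel_measurable_outer_square [measurable]
  have "Mhat = (\<lambda>w. (1 / real (N w)) *\<^sub>R (\<Sum>i=1..n. outer_square (theta_exc \<omega> t (Xs i w))))"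
    by (simp add: Mhat_def N_def emp_moment_matrix_def fun_eq_iff)
  also have "\<dots> \<in> borel_measurable M" by measurable
  finally show ?thesis .
qed

lemma radius_measurable [measurable]: "radius l u v \<in> borel_measurable M"
proof -
  have "radius l u v = (\<lambda>w. sqrt (real (min p (CARD('d) - p))
      * ((1 / real (N w) * (\<Sum>i=1..n. norm (theta_exc \<omega> t (Xs i w)) ^ 4) - (norm (Mhat w))\<^sup>2) / (real l - 1)
          + v / real l)) + u)"
    by (simp add: radius_def band_radius_def S_tilde_def trace_square_symmetric
        transpose_emp_moment_matrix Mhat_def N_def fun_eq_iff)
  also have "\<dots> \<in> borel_measurable M" by measurable
  finally show ?thesis .
qed

lemma sup_dev_eq: "sup_dev w = max (residual_sup p (Mhat w - \<mu>)) (residual_sup p (- (Mhat w - \<mu>)))"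
  unfolding sup_dev_def by (rule SUP_abs_residual[OF p])

lemma sup_dev_measurable [measurable]: "sup_dev \<in> borel_measurable M"
proof -
  note borel_measurable_residual_sup[OF p, measurable]
  show ?thesis unfolding sup_dev_eq[abs_def] by measurable
qed

lemma sup_dev_upper:
  assumes "V \<in> subspaces_of_dim p"
  shows "\<bar>proj_matrix (V\<^sup>\<bottom>) \<bullet> (Mhat w - \<mu>)\<bar> \<le> sup_dev w"
  using residual_le_sup[OF assms, of "Mhat w - \<mu>"] residual_le_sup[OF assms, of "- (Mhat w - \<mu>)"]
  unfolding sup_dev_eq inner_minus_right by linarith

lemma sup_dev_le_iff: "sup_dev w \<le> c \<longleftrightarrow> (\<forall>V\<in>subspaces_of_dim p. \<bar>proj_matrix (V\<^sup>\<bottom>) \<bullet> (Mhat w - \<mu>)\<bar> \<le> c)"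
proof
  assume "\<forall>V\<in>subspaces_of_dim p. \<bar>proj_matrix (V\<^sup>\<bottom>) \<bullet> (Mhat w - \<mu>)\<bar> \<le> c"
  then show "sup_dev w \<le> c"
    unfolding sup_dev_def by (intro cSUP_least subspaces_of_dim_nonempty p) auto
qed (use sup_dev_upper order_trans in blast)

lemma risk_diff:
  assumes "V \<in> subspaces_of_dim p"
  shows "emp_risk \<omega> n t (\<lambda>i. Xs i w) V - true_risk M \<omega> X t V = proj_matrix (V\<^sup>\<bottom>) \<bullet> (Mhat w - \<mu>)"
  using true_risk_eq_inner[OF prob_space_axioms X theta_measurable(1) norm_theta_exc]
    subspaces_of_dimD(1)[OF assms]
  by (simp add: emp_risk_eq_inner Mhat_def \<mu>_def inner_diff_right)

lemma pattern_eq_rectangle: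
  assumes "J \<subseteq> {1..n}"
  shows "pattern J = {w \<in> space M. \<forall>i\<in>{1..n}. Xs i w \<in> (if i \<in> J then {x. norm x > t} else {x. norm x \<le> t})}"
  using assms by (auto simp: pattern_def exceedances_def) (meson atLeastAtMost_iff not_less)

lemma pattern_events [measurable]:
  assumes "J \<subseteq> {1..n}"
  shows "pattern J \<in> events"
  unfolding pattern_eq_rectangle[OF assms]
proof (rule sets.sets_Collect_finite_All)
  fix i assume [measurable]: "i \<in> {1..n}"
  show "{w \<in> space M. Xs i w \<in> (if i \<in> J then {x. norm x > t} else {x. norm x \<le> t})} \<in> events"
    by (cases "i \<in> J") simp_all
qed simp

text \<open>Given the index set of the exceedances, the exceedances are an i.i.d. sample of
  deterministic size from the law of \<open>X\<close> given an exceedance.\<close>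

lemma iid_given_pattern:
  assumes J: "J \<subseteq> {1..n}" "J \<noteq> {}" and pos: "prob (pattern J) \<noteq> 0"
  shows "iid_bounded_sample (uniform_measure M (pattern J)) borel Xs J (exceedance_law M X t)
           (\<lambda>x. outer_square (theta_exc \<omega> t x))"
proof -
  note borel_measurable_outer_square [measurable]
  define A :: "nat \<Rightarrow> (real^'d) set" where "A i = (if i \<in> J then {x. norm x > t} else {x. norm x \<le> t})" for i
  have A: "A i \<in> sets borel" for i
    by (simp add: A_def)
  have E: "pattern J = {w \<in> space M. \<forall>i\<in>{1..n}. Xs i w \<in> A i}"
    unfolding A_def by (rule pattern_eq_rectangle[OF J(1)])
  note cond = prob_space_conditioned_on_rectangle[OF indep finite_atLeastAtMost A pos[unfolded E], folded E]
    measure_conditioned_on_rectangle[OF indep finite_atLeastAtMost A pos[unfolded E], folded E]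
    indep_vars_conditioned_on_rectangle[OF indep finite_atLeastAtMost A pos[unfolded E], folded E]
  interpret U: prob_space "uniform_measure M (pattern J)" by (rule cond(1))
  let ?A = "{w \<in> space M. norm (X w) > t}"
  have law: "distr (uniform_measure M (pattern J)) borel (Xs j) = exceedance_law M X t" if j: "j \<in> J" for j
  proof (rule measure_eqI)
    fix B :: "(real^'d) set" assume "B \<in> sets (distr (uniform_measure M (pattern J)) borel (Xs j))"
    then have B [measurable]: "B \<in> sets borel" by simp
    have jn [measurable]: "j \<in> {1..n}" using j J by auto
    have AX: "?A \<in> events" by measurable
    have Aj: "A j = {x. norm x > t}" using j by (simp add: A_def)
    have pA: "prob ?A \<noteq> 0"
    proof
      assume "prob ?A = 0"
      then have "prob {w \<in> space M. Xs j w \<in> A j} = 0"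
        using prob_Xs[OF jn A[of j]] by (simp add: Aj)
      moreover have "prob (pattern J) \<le> prob {w \<in> space M. Xs j w \<in> A j}"
        using jn A by (intro finite_measure_mono) (auto simp: E)
      ultimately show False using pos measure_nonneg[of M "pattern J"] by linarith
    qed
    then have "prob_space (uniform_measure M ?A)"
      using AX by (intro prob_space_uniform_measure) (auto simp: emeasure_eq_measure)
    then interpret UA: prob_space "uniform_measure M ?A" .
    have BX: "{w \<in> space M. X w \<in> B} \<in> events" by measurable
    have "emeasure (distr (uniform_measure M (pattern J)) borel (Xs j)) B
        = measure (uniform_measure M (pattern J)) {w \<in> space M. Xs j w \<in> B}"
      by (simp add: emeasure_distr U.emeasure_eq_measure vimage_def Int_def conj_commute)
    also have "\<dots> = prob {w \<in> space M. X w \<in> A j \<inter> B} / prob {w \<in> space M. X w \<in> A j}"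
      by (simp only: cond(2)[OF jn B] prob_Xs[OF jn A] prob_Xs[OF jn sets.Int[OF A B]])
    also have "\<dots> = measure (uniform_measure M ?A) {w \<in> space M. X w \<in> B}"
      using AX BX pA by (subst measure_uniform_measure)
        (auto simp: emeasure_eq_measure Aj intro!: arg_cong2[where f="(/)"] arg_cong[where f=prob])
    also have "\<dots> = emeasure (exceedance_law M X t) B"
      by (simp add: exceedance_law_def emeasure_distr UA.emeasure_eq_measure vimage_def Int_def conj_commute)
    finally show "emeasure (distr (uniform_measure M (pattern J)) borel (Xs j)) B
        = emeasure (exceedance_law M X t) B" by simp
  qed (simp add: exceedance_law_def)
  show ?thesis
  proof unfold_locales
    show "finite J" using J(1) by (rule finite_subset) simp
    show "U.indep_vars (\<lambda>_. borel) Xs J"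
      by (rule U.indep_vars_subset[OF cond(3) J(1)])
    show "norm (outer_square (theta_exc \<omega> t x)) \<le> 1" for x
      using norm_theta_exc by (simp add: norm_outer_square power_le_one)
  qed (use J(2) law in auto)
qed

text \<open>On \<open>pattern J\<close> the empirical quantities, which sum over all observations, coincide with the sample
  mean and variance over \<open>J\<close>, to which the bound for i.i.d. samples applies.\<close>

lemma deviation_given_pattern:
  assumes J: "J \<subseteq> {1..n}" "card J > 1" and u: "u > 0" and v: "v > 0"
  shows "prob {w \<in> pattern J. sup_dev w \<ge> radius (card J) u v w}
    \<le> (2 * exp (- 2 * real (card J) * u\<^sup>2) + exp (- real (card J) * v\<^sup>2 / 2)) * prob (pattern J)"
proof (cases "prob (pattern J) = 0")
  case True
  have "prob {w \<in> pattern J. sup_dev w \<ge> radius (card J) u v w} \<le> prob (pattern J)"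
    using J by (intro finite_measure_mono pattern_events) auto
  with True show ?thesis by simp
next
  case False
  have "J \<noteq> {}" using J by auto
  note iid = iid_given_pattern[OF J(1) this False]
  interpret S: iid_bounded_sample "uniform_measure M (pattern J)" borel Xs J "exceedance_law M X t"
    "\<lambda>x. outer_square (theta_exc \<omega> t x)" by (rule iid)
  let ?E = "{w \<in> space M. sup_dev w \<ge> radius (card J) u v w}"
  let ?Y = "\<lambda>w j. outer_square (theta_exc \<omega> t (Xs j w))"
  let ?F = "{w \<in> space M. (SUP V\<in>subspaces_of_dim p. \<bar>proj_matrix (V\<^sup>\<bottom>) \<bullet> (sample_mean J (?Y w) - S.pop_mean)\<bar>)
      \<ge> sqrt (real (min p (CARD('d) - p))
            * (sample_variance J (?Y w) / (real (card J) - 1) + v / real (card J))) + u}"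
  have PE: "pattern J \<inter> ?E = {w \<in> pattern J. sup_dev w \<ge> radius (card J) u v w}"
    by (auto simp: pattern_def)
  have pop_mean: "S.pop_mean = \<mu>"
    by (simp add: S.pop_mean_def \<mu>_def moment_matrix_def)
  have PF: "pattern J \<inter> ?F = pattern J \<inter> ?E"
    unfolding sup_dev_def radius_def band_radius_def Mhat_def S_tilde_eq_sample_variance
      emp_moment_matrix_eq_sample_mean pop_mean
    by (auto simp: pattern_def)
  have F: "?F \<in> events"
  proof -
    note borel_measurable_outer_square [measurable] borel_measurable_residual_sup[OF p, measurable]
    have [measurable]: "(\<lambda>w. sample_mean J (?Y w)) \<in> borel_measurable M" "(\<lambda>w. sample_variance J (?Y w)) \<in> borel_measurable M"
      using J(1) Xs unfolding sample_variance_def sample_mean_def by measurable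
    show ?thesis unfolding SUP_abs_residual[OF p] by measurable
  qed
  have "measure (uniform_measure M (pattern J)) ?F
      \<le> 2 * exp (- 2 * real (card J) * u\<^sup>2) + exp (- real (card J) * v\<^sup>2 / 2)"
    using uniform_residual_deviation[OF iid norm_theta_exc p J(2) u v] by simp
  also have "measure (uniform_measure M (pattern J)) ?F = prob (pattern J \<inter> ?F) / prob (pattern J)"
    using False F by (intro measure_uniform_measure) (auto simp: emeasure_eq_measure)
  finally show ?thesis
    using False by (simp add: PF PE pos_divide_le_eq zero_less_measure_iff)
qed

lemma deviation_given_N:
  assumes l: "l > 1" and u: "u > 0" and v: "v > 0"
  shows "prob {w \<in> space M. sup_dev w \<ge> radius l u v w \<and> N w = l}
    \<le> (2 * exp (- 2 * real l * u\<^sup>2) + exp (- real l * v\<^sup>2 / 2)) * prob {w \<in> space M. N w = l}"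
    (is "_ \<le> ?c * _")
proof -
  define \<J> where "\<J> = {J. J \<subseteq> {1..n} \<and> card J = l}"
  have fin: "finite \<J>" unfolding \<J>_def by simp
  let ?B = "\<lambda>J. {w \<in> pattern J. sup_dev w \<ge> radius l u v w}"
  have B: "?B J \<in> events" if "J \<in> \<J>" for J
  proof -
    have "?B J = pattern J \<inter> {w \<in> space M. sup_dev w \<ge> radius l u v w}"
      by (auto simp: pattern_def)
    also have "\<dots> \<in> events"
      using that by (intro sets.Int pattern_events) (auto simp: \<J>_def)
    finally show ?thesis .
  qed
  have mem: "exceedances n t (\<lambda>i. Xs i w) \<in> \<J> \<longleftrightarrow> N w = l" for w
    by (auto simp: \<J>_def N_def num_exc_eq_card exceedances_def)
  have "{w \<in> space M. sup_dev w \<ge> radius l u v w \<and> N w = l} = (\<Union>J\<in>\<J>. ?B J)"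
    using mem by (auto simp: pattern_def)
  then have "prob {w \<in> space M. sup_dev w \<ge> radius l u v w \<and> N w = l} \<le> (\<Sum>J\<in>\<J>. prob (?B J))"
    using B fin by (simp only:) (intro measure_UNION_le; simp)
  also have "\<dots> \<le> (\<Sum>J\<in>\<J>. ?c * prob (pattern J))"
    using deviation_given_pattern[OF _ _ u v] l by (intro sum_mono) (auto simp: \<J>_def)
  also have "\<dots> = ?c * prob (\<Union>J\<in>\<J>. pattern J)"
    unfolding sum_distrib_left[symmetric]
    by (subst finite_measure_finite_Union[OF fin])
      (auto simp: \<J>_def disjoint_family_on_def pattern_def intro!: pattern_events[unfolded pattern_def])
  also have "(\<Union>J\<in>\<J>. pattern J) = {w \<in> space M. N w = l}"
    using mem by (auto simp: pattern_def)
  finally show ?thesis .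
qed

text \<open>Truncating the band at zero is harmless, since risks are nonnegative.  The right-hand side is
  measurable, hence so is the event of uniform coverage.\<close>

lemma risk_in_conf_band_iff:
  assumes "l > 1"
  shows "(\<forall>V\<in>subspaces_of_dim p. true_risk M \<omega> X t V \<in> conf_band \<omega> p n t u v l (\<lambda>i. Xs i w) V)
    \<longleftrightarrow> sup_dev w \<le> radius l (u l) (v l) w"
proof -
  have "true_risk M \<omega> X t V \<ge> 0" for V
    by (simp add: true_risk_def)
  then show ?thesis
    unfolding sup_dev_le_iff using assms
    by (intro ball_cong refl)
      (auto simp: conf_band_def radius_def abs_le_iff simp flip: risk_diff)
qed

text \<open>Stated with unnormalised probabilities, so that null events need no separate treatment
  when summing over \<open>l\<close>.\<close>

lemma coverage_given_N:
  assumes \<alpha>: "0 < \<alpha>" "\<alpha> < 1"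
    and uv: "\<And>l. l > 1 \<Longrightarrow> u l > 0 \<and> v l > 0 \<and>
      2 * exp (- 2 * real l * (u l)\<^sup>2) + exp (- real l * (v l)\<^sup>2 / 2) \<le> 1 - \<alpha>"
  defines "C l \<equiv> {w \<in> space M. (\<forall>V\<in>subspaces_of_dim p.
      true_risk M \<omega> X t V \<in> conf_band \<omega> p n t u v l (\<lambda>i. Xs i w) V) \<and> N w = l}"
  shows "C l \<in> events" and "\<alpha> * prob {w \<in> space M. N w = l} \<le> prob (C l)"
proof -
  have *: "C l \<in> events \<and> \<alpha> * prob {w \<in> space M. N w = l} \<le> prob (C l)"
  proof (cases "l > 1")
    case True
    have C: "C l = {w \<in> space M. sup_dev w \<le> radius l (u l) (v l) w \<and> N w = l}"
      unfolding C_def risk_in_conf_band_iff[OF True] by simp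
    let ?B = "{w \<in> space M. sup_dev w \<ge> radius l (u l) (v l) w \<and> N w = l}"
    have B: "?B \<in> events" and ev: "C l \<in> events"
      unfolding C by measurable
    have "prob {w \<in> space M. N w = l} \<le> prob (C l \<union> ?B)"
      using B ev by (intro finite_measure_mono) (auto simp: C)
    also have "\<dots> \<le> prob (C l) + prob ?B"
      by (rule measure_Un_le[OF ev B])
    also have "prob ?B \<le> (2 * exp (- 2 * real l * (u l)\<^sup>2) + exp (- real l * (v l)\<^sup>2 / 2))
        * prob {w \<in> space M. N w = l}"
      using uv[OF True] by (intro deviation_given_N True) auto
    also have "\<dots> \<le> (1 - \<alpha>) * prob {w \<in> space M. N w = l}"
      using uv[OF True] by (intro mult_right_mono) auto
    finally show ?thesis using ev by (simp add: algebra_simps)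
  next
    case False
    have "true_risk M \<omega> X t V \<ge> 0" for V
      by (simp add: true_risk_def)
    with False have C: "C l = {w \<in> space M. N w = l}"
      by (auto simp: C_def conf_band_def)
    have "\<alpha> * prob {w \<in> space M. N w = l} \<le> 1 * prob {w \<in> space M. N w = l}"
      using \<alpha> by (intro mult_right_mono) auto
    then show ?thesis unfolding C by simp
  qed
  then show "C l \<in> events" "\<alpha> * prob {w \<in> space M. N w = l} \<le> prob (C l)"
    by auto
qed

lemma coverage:
  assumes \<alpha>: "0 < \<alpha>" "\<alpha> < 1"
    and uv: "\<And>l. l > 1 \<Longrightarrow> u l > 0 \<and> v l > 0 \<and>
      2 * exp (- 2 * real l * (u l)\<^sup>2) + exp (- real l * (v l)\<^sup>2 / 2) \<le> 1 - \<alpha>"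
  shows "\<alpha> \<le> prob {w \<in> space M. \<forall>V\<in>subspaces_of_dim p.
      true_risk M \<omega> X t V \<in> conf_band \<omega> p n t u v (N w) (\<lambda>i. Xs i w) V}"
proof -
  define C where "C l = {w \<in> space M. (\<forall>V\<in>subspaces_of_dim p.
      true_risk M \<omega> X t V \<in> conf_band \<omega> p n t u v l (\<lambda>i. Xs i w) V) \<and> N w = l}" for l
  have C: "C l \<in> events" "\<alpha> * prob {w \<in> space M. N w = l} \<le> prob (C l)" for l
    unfolding C_def by (rule coverage_given_N[OF \<alpha> uv]; assumption)+
  have N: "N w \<le> n" for w
  proof -
    have "exceedances n t (\<lambda>i. Xs i w) \<subseteq> {1..n}"
      by (auto simp: exceedances_def)
    from card_mono[OF _ this] show ?thesis
      by (simp add: N_def num_exc_eq_card)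
  qed
  have "\<alpha> = \<alpha> * prob (\<Union>l\<in>{..n}. {w \<in> space M. N w = l})"
  proof -
    have "(\<Union>l\<in>{..n}. {w \<in> space M. N w = l}) = space M"
      using N by auto
    then show ?thesis by (simp add: prob_space)
  qed
  also have "\<dots> = (\<Sum>l\<le>n. \<alpha> * prob {w \<in> space M. N w = l})"
    unfolding sum_distrib_left[symmetric]
    by (subst finite_measure_finite_Union) (auto simp: disjoint_family_on_def)
  also have "\<dots> \<le> (\<Sum>l\<le>n. prob (C l))"
    by (intro sum_mono C)
  also have "\<dots> = prob (\<Union>l\<le>n. C l)"
    using C by (subst finite_measure_finite_Union) (auto simp: disjoint_family_on_def C_def)
  also have "(\<Union>l\<le>n. C l) = {w \<in> space M. \<forall>V\<in>subspaces_of_dim p.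
      true_risk M \<omega> X t V \<in> conf_band \<omega> p n t u v (N w) (\<lambda>i. Xs i w) V}"
    using N by (auto simp: C_def)
  finally show ?thesis .
qed

end

section \<open>Uniform confidence bands\<close>

theorem theorem3p6:
  fixes M :: "'a measure"
    and X :: "'a \<Rightarrow> real^'d"
    and Xs :: "nat \<Rightarrow> 'a \<Rightarrow> real^'d"
    and \<omega> :: "real^'d \<Rightarrow> real"
    and n p :: nat
    and t :: real
  assumes "prob_space M"
    and "X \<in> borel_measurable M"
    and "regularly_varying M X"
    and "\<exists>s\<^sub>0. continuous_on {s\<^sub>0..} (cdf (distr M borel (\<lambda>w. norm (X w))))"
    and "n \<ge> 1"
    and "prob_space.indep_vars M (\<lambda>_. borel) Xs {1..n}"
    and "\<And>i. i \<in> {1..n} \<Longrightarrow> distr M borel (Xs i) = distr M borel X"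
    and "\<omega> \<in> borel_measurable (restrict_space borel (- {0}))"
    and "\<And>x. x \<noteq> 0 \<Longrightarrow> \<omega> x > 0"
    and "\<And>x. x \<noteq> 0 \<Longrightarrow> \<omega> x \<le> 1 / norm x"
    and "1 \<le> p" and "p \<le> CARD('d)"
    and "t > 0"
  defines "N \<equiv> (\<lambda>w. num_exc n t (\<lambda>i. Xs i w))"
    and "Rhat \<equiv> (\<lambda>w. emp_risk \<omega> n t (\<lambda>i. Xs i w))"
    and "R \<equiv> true_risk M \<omega> X t"
    and "S \<equiv> (\<lambda>w. S_tilde \<omega> n t (\<lambda>i. Xs i w))"
  shows
    "(\<forall>l>1. \<forall>u>0. \<forall>v>0. \<P>(w in M. N w = l) > 0 \<longrightarrow>
        \<P>(w in M.
            (SUP V\<in>subspaces_of_dim p. \<bar>Rhat w V - R V\<bar>)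
              \<ge> sqrt (real (min p (CARD('d) - p)) * (S w / (real l - 1) + v / real l)) + u
          \<bar> N w = l)
        \<le> 2 * exp (- 2 * real l * u\<^sup>2) + exp (- real_of_int \<lfloor>real l / 2\<rfloor> * v\<^sup>2 / 2)) \<and>
     (\<forall>\<alpha> (u :: nat \<Rightarrow> real) (v :: nat \<Rightarrow> real).
        0 < \<alpha> \<and> \<alpha> < 1 \<and>
        (\<forall>l>1. u l > 0 \<and> v l > 0 \<and>
           2 * exp (- 2 * real l * (u l)\<^sup>2) + exp (- real_of_int \<lfloor>real l / 2\<rfloor> * (v l)\<^sup>2 / 2)
             = 1 - \<alpha>) \<longrightarrow>
        (\<forall>l>1. \<P>(w in M. N w = l) > 0 \<longrightarrow>
           \<P>(w in M. \<forall>V\<in>subspaces_of_dim p.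
                R V \<in> conf_band \<omega> p n t u v l (\<lambda>i. Xs i w) V \<bar> N w = l) \<ge> \<alpha>) \<and>
        \<P>(w in M. \<forall>V\<in>subspaces_of_dim p.
             R V \<in> conf_band \<omega> p n t u v (N w) (\<lambda>i. Xs i w) V) \<ge> \<alpha>)"
proof -
  interpret S: exceedance_sample M X Xs \<omega> n p t
    using assms(1,2,6-10,12) by (simp add: exceedance_sample_def exceedance_sample_axioms_def)
  have N_eq: "S.N = N"
    by (simp add: fun_eq_iff S.N_def N_def)
  have sup_dev_eq: "(SUP V\<in>subspaces_of_dim p. \<bar>Rhat w V - R V\<bar>) = S.sup_dev w" for w
    unfolding S.sup_dev_def Rhat_def R_def by (intro SUP_cong refl) (simp add: S.risk_diff)
  have radius_eq: "sqrt (real (min p (CARD('d) - p)) * (S w / (real l - 1) + v / real l)) + u = S.radius l u v w"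
    for l u v w
    by (simp add: S_def S.radius_def band_radius_def)
  have floor: "exp (- real l * v\<^sup>2 / 2) \<le> exp (- real_of_int \<lfloor>real l / 2\<rfloor> * v\<^sup>2 / 2)" for l and v :: real
  proof -
    have "real_of_int \<lfloor>real l / 2\<rfloor> \<le> real l" by linarith
    then show ?thesis by (simp add: mult_right_mono)
  qed
  show ?thesis
  proof (intro conjI allI impI)
    fix l :: nat and u v :: real
    assume l: "l > 1" and u: "u > 0" and v: "v > 0" and pos: "\<P>(w in M. N w = l) > 0"
    have "\<P>(w in M. S.sup_dev w \<ge> S.radius l u v w \<bar> N w = l)
        \<le> 2 * exp (- 2 * real l * u\<^sup>2) + exp (- real l * v\<^sup>2 / 2)"
      using S.deviation_given_N[OF l u v] pos
      by (simp add: cond_prob_def N_eq pos_divide_le_eq)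
    also have "\<dots> \<le> 2 * exp (- 2 * real l * u\<^sup>2) + exp (- real_of_int \<lfloor>real l / 2\<rfloor> * v\<^sup>2 / 2)"
      using floor by simp
    finally show "\<P>(w in M. (SUP V\<in>subspaces_of_dim p. \<bar>Rhat w V - R V\<bar>)
          \<ge> sqrt (real (min p (CARD('d) - p)) * (S w / (real l - 1) + v / real l)) + u \<bar> N w = l)
        \<le> 2 * exp (- 2 * real l * u\<^sup>2) + exp (- real_of_int \<lfloor>real l / 2\<rfloor> * v\<^sup>2 / 2)"
      unfolding sup_dev_eq radius_eq .
  next
    fix \<alpha> :: real and u v :: "nat \<Rightarrow> real"
    assume *: "0 < \<alpha> \<and> \<alpha> < 1 \<and> (\<forall>l>1. u l > 0 \<and> v l > 0 \<and>
      2 * exp (- 2 * real l * (u l)\<^sup>2) + exp (- real_of_int \<lfloor>real l / 2\<rfloor> * (v l)\<^sup>2 / 2) = 1 - \<alpha>)"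
    then have \<alpha>: "0 < \<alpha>" "\<alpha> < 1" by auto
    have uv: "u l > 0 \<and> v l > 0 \<and>
      2 * exp (- 2 * real l * (u l)\<^sup>2) + exp (- real l * (v l)\<^sup>2 / 2) \<le> 1 - \<alpha>" if "l > 1" for l
      using *[THEN conjunct2, THEN conjunct2, rule_format, OF that] floor[of l "v l"] by linarith
    show "\<P>(w in M. \<forall>V\<in>subspaces_of_dim p. R V \<in> conf_band \<omega> p n t u v (N w) (\<lambda>i. Xs i w) V) \<ge> \<alpha>"
      using S.coverage[of \<alpha> u v] \<alpha> uv by (simp add: N_eq R_def)
    fix l :: nat assume "l > 1" and pos: "\<P>(w in M. N w = l) > 0"
    show "\<P>(w in M. \<forall>V\<in>subspaces_of_dim p. R V \<in> conf_band \<omega> p n t u v l (\<lambda>i. Xs i w) V \<bar> N w = l) \<ge> \<alpha>"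
      using S.coverage_given_N(2)[of \<alpha> u v l] \<alpha> uv pos
      by (simp add: cond_prob_def N_eq R_def pos_le_divide_eq)
  qed
qed

end
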